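(* Let $N\ge 3$, let $\mathcal{X}\in\mathbb{R}^{I_1\times\cdots\times I_N}$, and let $\mathcal{G}^{(j)}\in\mathbb{R}^{R_{j-1}\times I_j\times R_j}$, $j\in[N]$, be core tensors with $R_0=R_N$ such that all subchain tensors are nonzero: $\mathcal{G}^{\neq m}\neq 0$ for all $m\in[N]$. Fix $n\in[N]$. Let $\varepsilon\in(0,1)$ and $\delta\in(0,1)$, let $S\sim\mathcal{D}(J,q^{\neq n})$, and let $$\tilde{\mathcal{Z}} = \operatorname*{arg\,min}_{\mathcal{Z}} \big\| S\, G^{\neq n}_{[2]} Z_{(2)}^\top - S\, X_{[n]}^\top \big\|_F ,$$ where $\mathcal{Z}$ ranges over $\mathbb{R}^{R_{n-1}\times I_n\times R_n}$. If $$J > \Big(\prod_{j=1}^N R_j^2\Big)\max\Big(\frac{16}{3(\sqrt2-1)^2}\ln\Big(\frac{4R_{n-1}R_n}{\delta}\Big),\ \frac{4}{\varepsilon\delta}\Big),$$ then with probability at least $1-\delta$, $$\big\| G^{\neq n}_{[2]} \tilde{Z}_{(2)}^\top - X_{[n]}^\top \big\|_F \le (1+\varepsilon)\min_{\mathcal{Z}} \big\| G^{\neq n}_{[2]} Z_{(2)}^\top - X_{[n]}^\top \big\|_F .$$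
   Context: For a positive integer $K$, $[K]=\{1,\dots,K\}$. $\|\cdot\|_F$ is the Frobenius norm and $\|\cdot\|_2$ the Euclidean norm. All tensors are real arrays. Mode indices are cyclic: index $0$ is identified with $N$ (so $R_0=R_N$, $r_0=r_N$). Multi-index: for indices $i_k\in[I_k]$, $k=1,\dots,N$, $\overline{i_1 i_2\cdots i_N} = 1+\sum_{k=1}^N (i_k-1)\prod_{j=1}^{k-1} I_j$, i.e. the first index varies fastest; analogously for other lists of indices with their own ranges. Unfoldings: for an $N$-way tensor $\mathcal{X}\in\mathbb{R}^{I_1\times\cdots\times I_N}$ the classical mode-$n$ unfolding is the matrix $X_{(n)}\in\mathbb{R}^{I_n\times\prod_{j\ne n}I_j}$ with $X_{(n)}(i_n,\overline{i_1\cdots i_{n-1}i_{n+1}\cdots i_N})=\mathcal{X}(i_1,\dots,i_N)$, and the mode-$n$ unfolding is the matrix $X_{[n]}\in\mathbb{R}^{I_n\times\prod_{j\ne n}I_j}$ with $X_{[n]}(i_n,\overline{i_{n+1}\cdots i_N i_1\cdots i_{n-1}})=\mathcal{X}(i_1,\dots,i_N)$. The same definitions apply to 3-way tensors, with the unfoldings of $\mathcal{G}^{(j)}$, $\mathcal{G}^{\neq n}$, $\mathcal{Z}$, $\tilde{\mathcal{Z}}$ written $G^{(j)}_{(2)}$, $G^{\neq n}_{[2]}$, $Z_{(2)}$, $\tilde Z_{(2)}$. Subchain tensor: given cores $\mathcal{G}^{(j)}\in\mathbb{R}^{R_{j-1}\times I_j\times R_j}$, $\mathcal{G}^{\neq n}\in\mathbb{R}^{R_n\times\prod_{j\neq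 n}I_j\times R_{n-1}}$ is defined by $$\mathcal{G}^{\neq n}(r_n,\overline{i_{n+1}\cdots i_N i_1\cdots i_{n-1}},r_{n-1})=\sum_{r_j:\ j\in[N]\setminus\{n-1,n\}}\ \prod_{j\in[N],\,j\ne n}\mathcal{G}^{(j)}(r_{j-1},i_j,r_j),$$ where each $r_j$ ranges over $[R_j]$. Thus $G^{\neq n}_{[2]}$ has size $\prod_{j\ne n}I_j\times R_{n-1}R_n$. Leverage scores: for $A\in\mathbb{R}^{K\times L}$ let $U\in\mathbb{R}^{K\times\operatorname{rank}(A)}$ contain the left singular vectors of $A$ (for nonzero singular values); $\ell_i(A)=\|U(i,:)\|_2^2$ for $i\in[K]$. Sampling distribution: $p^{(j)}(i_j)=\ell_{i_j}(G^{(j)}_{(2)})/\operatorname{rank}(G^{(j)}_{(2)})$ for $i_j\in[I_j]$ (well-defined since all cores are nonzero when all subchains are), and $q^{\neq n}\in\mathbb{R}^{\prod_{j\ne n}I_j}$ is $q^{\neq n}(\overline{i_{n+1}\cdots i_N i_1\cdots i_{n-1}})=\prod_{j\in[N],\,j\neq n}p^{(j)}(i_j)$; it is a probability distribution on $[\prod_{j\ne n}I_j]$. Sampling matrix: for a probability distribution $q$ on $[K]$, let $v\in[K]^J$ be a random vector with independent entries with $\mathbb{P}(v(j)=i)=q(i)$. Let $\Omega\in\mathbb{R}^{J\times K}$ have rows $\Omega(j,:)=e_{v(j)}^\top$ ($e_i$ the $i$th column of the $K\times K$ identity), and let $R\in\mathbb{R}^{J\times J}$ be diagonal with $R(j,j)=1/\sqrt{J\,q(v(j))}$.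 Then $S=R\Omega\in\mathbb{R}^{J\times K}$ is called a sampling matrix with parameters $(J,q)$, written $S\sim\mathcal{D}(J,q)$. *)

theory Defs
  imports "HOL-Probability.Probability" "Jordan_Normal_Form.DL_Rank"
begin

text \<open>
  All indices are 0-based: \<open>[K]\<close> is \<open>{..<K}\<close>, the modes of an \<open>N\<close>-way tensor are
  \<open>0, \<dots>, N - 1\<close>, and mode indices are read modulo \<open>N\<close>.

  A tensor of dimensions \<open>ds\<close> is a function on index lists that vanishes outside the
  admissible indices, so that equality of functions is equality of arrays.
\<close>

type_synonym tensor = "nat list \<Rightarrow> real"

definition indices :: "nat list \<Rightarrow> nat list set" where
  "indices ds = {i. list_all2 (<) i ds}"

definition tensors :: "nat list \<Rightarrow> tensor set" where
  "tensors ds = {T. \<forall>i. i \<notin> indices ds \<longrightarrow> T i = 0}"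

definition multi_index :: "nat list \<Rightarrow> nat list \<Rightarrow> nat" where
  "multi_index ds i = (\<Sum>k<length ds. i ! k * (\<Prod>j<k. ds ! j))"

text \<open>The inverse of \<^const>\<open>multi_index\<close>; see \<open>digits_multi_index\<close> below.\<close>

fun digits :: "nat list \<Rightarrow> nat \<Rightarrow> nat list" where
  "digits [] b = []"
| "digits (d # ds) b = (b mod d) # digits ds (b div d)"

text \<open>
  Given a list \<open>i\<close> of length \<open>N\<close>, \<open>others n i\<close> is \<open>i\<^sub>0 \<dots> i\<^sub>n\<^sub>-\<^sub>1 i\<^sub>n\<^sub>+\<^sub>1 \<dots> i\<^sub>N\<^sub>-\<^sub>1\<close> and
  \<open>cyc_others n i\<close> is \<open>i\<^sub>n\<^sub>+\<^sub>1 \<dots> i\<^sub>N\<^sub>-\<^sub>1 i\<^sub>0 \<dots> i\<^sub>n\<^sub>-\<^sub>1\<close>. The functions \<open>insert_at\<close> and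
  \<open>cyc_insert_at\<close> put the entry \<open>i\<^sub>n\<close> back.
\<close>

definition others :: "nat \<Rightarrow> nat list \<Rightarrow> nat list" where
  "others n i = take n i @ drop (Suc n) i"

definition cyc_others :: "nat \<Rightarrow> nat list \<Rightarrow> nat list" where
  "cyc_others n i = drop (Suc n) i @ take n i"

definition insert_at :: "nat \<Rightarrow> nat \<Rightarrow> nat list \<Rightarrow> nat list" where
  "insert_at n a js = take n js @ a # drop n js"

definition cyc_insert_at :: "nat \<Rightarrow> nat \<Rightarrow> nat list \<Rightarrow> nat list" where
  "cyc_insert_at n a js = drop (length js - n) js @ a # take (length js - n) js"

text \<open>
  The unfoldings \<open>T\<^sub>(\<^sub>n\<^sub>)\<close> and \<open>T\<^sub>[\<^sub>n\<^sub>]\<close> of a tensor of dimensions \<open>ds\<close>. The column index is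
  decoded by \<^const>\<open>digits\<close>; the defining equations in terms of \<^const>\<open>multi_index\<close> are
  \<open>unfold_classical_entry\<close> and \<open>unfold_cyclic_entry\<close> below.
\<close>

definition unfold_classical :: "nat list \<Rightarrow> nat \<Rightarrow> tensor \<Rightarrow> real mat" where
  "unfold_classical ds n T =
     mat (ds ! n) (\<Prod>j\<in>{..<length ds} - {n}. ds ! j)
       (\<lambda>(a, b). T (insert_at n a (digits (others n ds) b)))"

definition unfold_cyclic :: "nat list \<Rightarrow> nat \<Rightarrow> tensor \<Rightarrow> real mat" where
  "unfold_cyclic ds n T =
     mat (ds ! n) (\<Prod>j\<in>{..<length ds} - {n}. ds ! j)
       (\<lambda>(a, b). T (cyc_insert_at n a (digits (cyc_others n ds) b)))"

definition cpred :: "nat \<Rightarrow> nat \<Rightarrow> nat" where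
  "cpred N j = (j + N - 1) mod N"

definition core_dims :: "nat \<Rightarrow> (nat \<Rightarrow> nat) \<Rightarrow> (nat \<Rightarrow> nat) \<Rightarrow> nat \<Rightarrow> nat list" where
  "core_dims N I R j = [R (cpred N j), I j, R j]"

definition subchain_dims :: "nat \<Rightarrow> (nat \<Rightarrow> nat) \<Rightarrow> (nat \<Rightarrow> nat) \<Rightarrow> nat \<Rightarrow> nat list" where
  "subchain_dims N I R n = [R n, \<Prod>j\<in>{..<N} - {n}. I j, R (cpred N n)]"

text \<open>
  The indices \<open>(i\<^sub>j)\<^sub>j\<close> encoded by \<open>b = multi_index (i\<^sub>n\<^sub>+\<^sub>1 \<dots> i\<^sub>N\<^sub>-\<^sub>1 i\<^sub>0 \<dots> i\<^sub>n\<^sub>-\<^sub>1)\<close>, as a list of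
  length \<open>N\<close>. Its entry at position \<open>n\<close> is a dummy that is never used.
\<close>

definition split_index :: "nat \<Rightarrow> (nat \<Rightarrow> nat) \<Rightarrow> nat \<Rightarrow> nat \<Rightarrow> nat list" where
  "split_index N I n b = cyc_insert_at n 0 (digits (cyc_others n (map I [0..<N])) b)"

text \<open>
  In the subchain tensor the values \<open>r n\<close> and \<open>r (n - 1)\<close> are pinned to the outer indices;
  the sum runs over all the other \<open>r j\<close>.
\<close>

definition subchain ::
  "nat \<Rightarrow> (nat \<Rightarrow> nat) \<Rightarrow> (nat \<Rightarrow> nat) \<Rightarrow> (nat \<Rightarrow> tensor) \<Rightarrow> nat \<Rightarrow> tensor" where
  "subchain N I R G n = (\<lambda>x.
     if x \<in> indices (subchain_dims N I R n) then
       (\<Sum>r\<in>{r \<in> Pi\<^sub>E {..<N} (\<lambda>j. {..<R j}). r n = x ! 0 \<and> r (cpred N n) = x ! 2}.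
          \<Prod>j\<in>{..<N} - {n}. G j [r (cpred N j), split_index N I n (x ! 1) ! j, r j])
     else 0)"

definition frob_norm :: "real mat \<Rightarrow> real" where
  "frob_norm A = sqrt (\<Sum>i<dim_row A. \<Sum>j<dim_col A. (A $$ (i, j))\<^sup>2)"

definition mat_rank :: "real mat \<Rightarrow> nat" where
  "mat_rank A = vec_space.rank (dim_row A) A"

text \<open>
  \<open>U\<close> is the left factor of a compact singular value decomposition \<open>A = U \<Sigma> V\<^sup>T\<close>, with
  \<open>rank A\<close> positive singular values \<open>s\<close>.
\<close>

definition left_singular_mat :: "real mat \<Rightarrow> real mat \<Rightarrow> bool" where
  "left_singular_mat A U \<longleftrightarrow>
     (let r = mat_rank A in
      U \<in> carrier_mat (dim_row A) r \<and>
      transpose_mat U * U = 1\<^sub>m r \<and>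
      (\<exists>V s. V \<in> carrier_mat (dim_col A) r \<and>
             transpose_mat V * V = 1\<^sub>m r \<and>
             (\<forall>k<r. 0 < s k) \<and>
             A = U * mat r r (\<lambda>(k, l). if k = l then s k else 0) * transpose_mat V))"

text \<open>The leverage scores do not depend on the choice of \<open>U\<close>.\<close>

definition leverage_score :: "real mat \<Rightarrow> nat \<Rightarrow> real" where
  "leverage_score A i =
     (let U = (SOME U. left_singular_mat A U) in \<Sum>k<dim_col U. (U $$ (i, k))\<^sup>2)"

definition core_prob ::
  "nat \<Rightarrow> (nat \<Rightarrow> nat) \<Rightarrow> (nat \<Rightarrow> nat) \<Rightarrow> (nat \<Rightarrow> tensor) \<Rightarrow> nat \<Rightarrow> nat \<Rightarrow> real" where
  "core_prob N I R G j i =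
     (let A = unfold_classical (core_dims N I R j) 1 (G j)
      in leverage_score A i / real (mat_rank A))"

definition subchain_prob ::
  "nat \<Rightarrow> (nat \<Rightarrow> nat) \<Rightarrow> (nat \<Rightarrow> nat) \<Rightarrow> (nat \<Rightarrow> tensor) \<Rightarrow> nat \<Rightarrow> nat \<Rightarrow> real" where
  "subchain_prob N I R G n b =
     (\<Prod>j\<in>{..<N} - {n}. core_prob N I R G j (split_index N I n b ! j))"

text \<open>
  \<open>S \<sim> D(J, q)\<close> as a random matrix on the probability space \<open>M\<close>, for a probability
  distribution \<open>q\<close> on \<open>{..<K}\<close>.
\<close>

definition sampling_matrix ::
  "'w measure \<Rightarrow> nat \<Rightarrow> nat \<Rightarrow> (nat \<Rightarrow> real) \<Rightarrow> ('w \<Rightarrow> real mat) \<Rightarrow> bool" where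
  "sampling_matrix M J K q S \<longleftrightarrow>
     (\<exists>v :: nat \<Rightarrow> 'w \<Rightarrow> nat.
        prob_space.indep_vars M (\<lambda>_. count_space {..<K}) v {..<J} \<and>
        (\<forall>j<J. \<forall>i<K. measure M {w \<in> space M. v j w = i} = q i) \<and>
        (\<forall>w\<in>space M. S w =
           mat J J (\<lambda>(j, l). if j = l then 1 / sqrt (real J * q (v j w)) else 0) *
           mat_of_rows K (map (\<lambda>j. unit_vec K (v j w)) [0..<J])))"


lemma multi_index_Nil [simp]: "multi_index [] i = 0"
  by (simp add: multi_index_def)

lemma multi_index_Cons [simp]:
  "multi_index (d # ds) (a # i) = a + d * multi_index ds i"
  unfolding multi_index_def list.size add_0_right add_Suc_right sum.lessThan_Suc_shift
  by (simp add: prod.lessThan_Suc_shift sum_distrib_left mult.left_commute del: prod.lessThan_Suc)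

lemma multi_index_less:
  "list_all2 (<) i ds \<Longrightarrow> multi_index ds i < prod_list ds"
proof (induction rule: list_all2_induct)
  case (Cons a i d ds)
  have "a + d * multi_index ds i < d + d * multi_index ds i" using Cons by simp
  also have "\<dots> = d * Suc (multi_index ds i)" by simp
  also have "\<dots> \<le> d * prod_list ds" using Cons by (intro mult_left_mono) auto
  finally show ?case by simp
qed simp

lemma digits_multi_index:
  "i \<in> indices ds \<Longrightarrow> digits ds (multi_index ds i) = i"
  unfolding indices_def mem_Collect_eq by (induction rule: list_all2_induct) auto

lemma others_prod:
  assumes "n < length ds"
  shows "prod_list (others n ds) = (\<Prod>j\<in>{..<length ds} - {n}. ds ! j)"
    and "prod_list (cyc_others n ds) = (\<Prod>j\<in>{..<length ds} - {n}. ds ! j)"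
proof -
  have *: "{..<length ds} - {n} = {0..<n} \<union> {Suc n..<length ds}" using assms by auto
  have a: "prod_list (take n ds) = (\<Prod>j\<in>{0..<n}. ds ! j)"
    using assms by (simp add: prod.list_conv_set_nth)
  have b: "prod_list (drop (Suc n) ds) = (\<Prod>j\<in>{Suc n..<length ds}. ds ! j)"
    unfolding prod.list_conv_set_nth
    by (rule prod.reindex_bij_witness[of _ "\<lambda>j. j - Suc n" "\<lambda>j. j + Suc n"])
      (use assms in \<open>auto simp: add.commute\<close>)
  have "(\<Prod>j\<in>{..<length ds} - {n}. ds ! j)
      = (\<Prod>j\<in>{0..<n}. ds ! j) * (\<Prod>j\<in>{Suc n..<length ds}. ds ! j)"
    unfolding * by (subst prod.union_disjoint) auto
  then show "prod_list (others n ds) = (\<Prod>j\<in>{..<length ds} - {n}. ds ! j)"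
    and "prod_list (cyc_others n ds) = (\<Prod>j\<in>{..<length ds} - {n}. ds ! j)"
    by (simp_all add: others_def cyc_others_def a b mult.commute)
qed

lemma others_indices:
  assumes "i \<in> indices ds"
  shows "others n i \<in> indices (others n ds)" "cyc_others n i \<in> indices (cyc_others n ds)"
  using assms unfolding indices_def others_def cyc_others_def
  by (auto intro!: list_all2_appendI list_all2_takeI list_all2_dropI)

lemma insert_at_others: "n < length i \<Longrightarrow> insert_at n (i ! n) (others n i) = i"
  by (simp add: insert_at_def others_def id_take_nth_drop[symmetric])

lemma cyc_insert_at_others:
  "n < length i \<Longrightarrow> cyc_insert_at n a (cyc_others n i) = i[n := a]"
  by (simp add: cyc_insert_at_def cyc_others_def upd_conv_take_nth_drop)

lemma unfold_classical_entry:
  assumes "i \<in> indices ds" "n < length ds"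
  shows "unfold_classical ds n T $$ (i ! n, multi_index (others n ds) (others n i)) = T i"
proof -
  have len: "length i = length ds" and "i ! n < ds ! n"
    using assms by (auto simp: indices_def list_all2_lengthD list_all2_nthD2)
  moreover have "multi_index (others n ds) (others n i) < prod_list (others n ds)"
    using others_indices(1)[OF assms(1)] by (simp add: indices_def multi_index_less)
  ultimately show ?thesis
    using assms by (simp add: unfold_classical_def others_prod(1)[symmetric]
        digits_multi_index others_indices insert_at_others)
qed

lemma unfold_cyclic_entry:
  assumes "i \<in> indices ds" "n < length ds"
  shows "unfold_cyclic ds n T $$ (i ! n, multi_index (cyc_others n ds) (cyc_others n i)) = T i"
proof -
  have len: "length i = length ds" and "i ! n < ds ! n"
    using assms by (auto simp: indices_def list_all2_lengthD list_all2_nthD2)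
  moreover have "multi_index (cyc_others n ds) (cyc_others n i) < prod_list (cyc_others n ds)"
    using others_indices(2)[OF assms(1)] by (simp add: indices_def multi_index_less)
  ultimately show ?thesis
    using assms by (simp add: unfold_cyclic_def others_prod(2)[symmetric]
        digits_multi_index others_indices cyc_insert_at_others)
qed

lemma split_index_multi_index:
  assumes "i \<in> indices (map I [0..<N])" "n < N" "j \<noteq> n"
  shows "split_index N I n (multi_index (cyc_others n (map I [0..<N])) (cyc_others n i)) ! j = i ! j"
proof -
  have "length i = N" using assms(1) by (auto simp: indices_def dest: list_all2_lengthD)
  then show ?thesis
    using assms by (simp add: split_index_def digits_multi_index others_indices cyc_insert_at_others)
qed

lemma subchain_entry:
  assumes "i \<in> indices (map I [0..<N])" "n < N" "a < R n" "c < R (cpred N n)"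
  shows "subchain N I R G n
           [a, multi_index (cyc_others n (map I [0..<N])) (cyc_others n i), c] =
         (\<Sum>r\<in>{r \<in> Pi\<^sub>E {..<N} (\<lambda>j. {..<R j}). r n = a \<and> r (cpred N n) = c}.
            \<Prod>j\<in>{..<N} - {n}. G j [r (cpred N j), i ! j, r j])"
proof -
  let ?ds = "map I [0..<N]"
  have "multi_index (cyc_others n ?ds) (cyc_others n i) < prod_list (cyc_others n ?ds)"
    using others_indices(2)[OF assms(1)] by (simp add: indices_def multi_index_less)
  also have "\<dots> = (\<Prod>j\<in>{..<N} - {n}. I j)" using assms(2) by (simp add: others_prod)
  finally have "[a, multi_index (cyc_others n ?ds) (cyc_others n i), c]
      \<in> indices (subchain_dims N I R n)"
    using assms by (simp add: indices_def subchain_dims_def)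
  then show ?thesis
    using assms by (auto simp: subchain_def split_index_multi_index intro!: sum.cong prod.cong)
qed

lemma subchain_prob_entry:
  assumes "i \<in> indices (map I [0..<N])" "n < N"
  shows "subchain_prob N I R G n (multi_index (cyc_others n (map I [0..<N])) (cyc_others n i)) =
         (\<Prod>j\<in>{..<N} - {n}. core_prob N I R G j (i ! j))"
  using assms by (auto simp: subchain_prob_def split_index_multi_index intro!: prod.cong)

end

theory Submission
  imports Defs
begin

text \<open>
  Let \<open>u\<close> be an orthonormal basis of the column space of \<open>A = G\<^sup>\<noteq>\<^sup>n\<^sub>[\<^sub>2\<^sub>]\<close>, let \<open>r\<close> be the rank of \<open>A\<close>,
  and let \<open>b\<close> be the part of \<open>B = X\<^sub>[\<^sub>n\<^sub>]\<^sup>T\<close> orthogonal to the column space; \<open>|b|\<close> is the optimal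
  error. All probabilistic estimates are second moments combined with Markov's inequality; the generous
  factor \<open>\<Prod>\<^sub>j R\<^sub>j\<^sup>2\<close> in the sample size makes them strong enough.

  \<^item> Since the column space of \<open>A\<close> is contained in the Kronecker product of the column spaces of
    the unfolded cores, and leverage scores are monotone in the column space, each row satisfies
    \<open>|u\<^sub>i|\<^sup>2 \<le> D q\<^sub>i\<close> with \<open>D = \<Prod>\<^sub>j\<^sub>\<noteq>\<^sub>n R\<^sub>j\<^sub>-\<^sub>1 R\<^sub>j\<close> (\<open>subchain_leverage_le\<close>).

  \<^item> \<open>S\<^sup>T S\<close> is a diagonal matrix of random weights with unbiased weighted sums. Adding variances
    entry by entry, the squared Frobenius error \<open>\<phi>\<close> of \<open>u\<^sup>T S\<^sup>T S u\<close> against the identity has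
    expectation at most \<open>D r / J\<close>, and \<open>g = |u\<^sup>T S\<^sup>T S b|\<^sup>2\<close> has expectation at most \<open>D |b|\<^sup>2 / J\<close>.

  \<^item> A minimizer of the sketched problem has residual \<open>u y - b\<close>, where the normal equations give
    \<open>(1 - sqrt \<phi>) |y| \<le> sqrt g\<close> (\<open>coordinate_error_bound\<close>). If \<open>2 \<phi> + g / (\<epsilon> |b|\<^sup>2) < 1\<close>, then
    \<open>|y|\<^sup>2 \<le> 2 \<epsilon> |b|\<^sup>2\<close>, and the squared error is at most \<open>(1 + 2 \<epsilon>) |b|\<^sup>2 \<le> (1 + \<epsilon>)\<^sup>2 |b|\<^sup>2\<close>.

  By Markov's inequality that condition fails with probability at most \<open>(2 D r + D / \<epsilon>) / J\<close>.
  Since \<open>\<Prod>\<^sub>j R\<^sub>j\<^sup>2 = D d\<close> with \<open>d = R\<^sub>n\<^sub>-\<^sub>1 R\<^sub>n \<ge> r\<close>, the sample size exceeds \<open>4 D d / (\<epsilon> \<delta>)\<close>, and the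
  failure probability is below \<open>\<delta>\<close>. Left singular vectors enter through the definition of
  leverage scores and as the basis \<open>u\<close>, so the singular value decomposition is derived as well.
\<close>

section \<open>Orthonormal systems and the singular value decomposition\<close>

text \<open>
  The columns of \<open>u\<close>, indexed by \<open>J\<close>, are orthonormal vectors of \<open>\<real>\<^sup>I\<close>. Arbitrary index sets are
  allowed because the Kronecker product of several bases is indexed by functions.
\<close>

definition orthonormal :: "'a set \<Rightarrow> 'b set \<Rightarrow> ('a \<Rightarrow> 'b \<Rightarrow> real) \<Rightarrow> bool" where
  "orthonormal I J u \<longleftrightarrow>
     (\<forall>a\<in>J. \<forall>b\<in>J. (\<Sum>i\<in>I. u i a * u i b) = (if a = b then 1 else 0))"

lemma orthonormalD:
  "orthonormal I J u \<Longrightarrow> a \<in> J \<Longrightarrow> b \<in> J \<Longrightarrow> (\<Sum>i\<in>I. u i a * u i b) = (if a = b then 1 else 0)"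
  by (simp add: orthonormal_def)

lemma orthonormal_inner:
  assumes "orthonormal I J u" "finite J"
  shows "(\<Sum>i\<in>I. (\<Sum>a\<in>J. u i a * y a) * (\<Sum>a\<in>J. u i a * z a)) = (\<Sum>a\<in>J. y a * z a)"
proof -
  have "(\<Sum>i\<in>I. (\<Sum>a\<in>J. u i a * y a) * (\<Sum>a\<in>J. u i a * z a))
      = (\<Sum>i\<in>I. \<Sum>a\<in>J. \<Sum>b\<in>J. (y a * z b) * (u i a * u i b))"
    by (simp add: sum_product algebra_simps)
  also have "\<dots> = (\<Sum>a\<in>J. \<Sum>b\<in>J. (y a * z b) * (\<Sum>i\<in>I. u i a * u i b))"
    by (subst sum.swap, intro sum.cong refl, subst sum.swap) (simp add: sum_distrib_left)
  also have "\<dots> = (\<Sum>a\<in>J. \<Sum>b\<in>J. if a = b then y a * z b else 0)"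
    using assms(1) by (intro sum.cong refl) (simp add: orthonormalD)
  also have "\<dots> = (\<Sum>a\<in>J. y a * z a)" using assms(2) by simp
  finally show ?thesis .
qed

lemma orthonormal_norm:
  assumes "orthonormal I J u" "finite J"
  shows "(\<Sum>i\<in>I. (\<Sum>a\<in>J. u i a * y a)\<^sup>2) = (\<Sum>a\<in>J. (y a)\<^sup>2)"
  using orthonormal_inner[OF assms, of y y] by (simp add: power2_eq_square)

text \<open>
  Subtracting from \<open>w\<close> its projection \<open>p\<close> onto the span of the columns leaves a vector of
  nonnegative squared length, and that length is the difference of the two sides.
\<close>

lemma bessel_inequality:
  assumes u: "orthonormal I J u" and J: "finite J"
  shows "(\<Sum>a\<in>J. (\<Sum>i\<in>I. w i * u i a)\<^sup>2) \<le> (\<Sum>i\<in>I. (w i)\<^sup>2)"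
proof -
  define c where "c a = (\<Sum>i\<in>I. w i * u i a)" for a
  define p where "p i = (\<Sum>a\<in>J. u i a * c a)" for i
  have "(\<Sum>i\<in>I. w i * p i) = (\<Sum>a\<in>J. \<Sum>i\<in>I. w i * (u i a * c a))"
    unfolding p_def by (subst sum.swap) (simp add: sum_distrib_left)
  also have "\<dots> = (\<Sum>a\<in>J. (c a)\<^sup>2)"
    by (simp add: c_def power2_eq_square sum_distrib_left sum_distrib_right mult_ac)
  finally have wp: "(\<Sum>i\<in>I. w i * p i) = (\<Sum>a\<in>J. (c a)\<^sup>2)" .
  have "0 \<le> (\<Sum>i\<in>I. (w i - p i)\<^sup>2)" by (rule sum_nonneg) simp
  also have "\<dots> = (\<Sum>i\<in>I. (w i)\<^sup>2) - 2 * (\<Sum>i\<in>I. w i * p i) + (\<Sum>i\<in>I. (p i)\<^sup>2)"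
    by (simp add: power2_diff sum.distrib sum_subtractf sum_distrib_left algebra_simps)
  also have "(\<Sum>i\<in>I. (p i)\<^sup>2) = (\<Sum>a\<in>J. (c a)\<^sup>2)"
    unfolding p_def by (rule orthonormal_norm[OF u J])
  finally show ?thesis using wp by (simp add: c_def)
qed

text \<open>
  Bessel's inequality bounds the squared length of every row by 1, while all squared entries
  together add up to the number of columns.
\<close>

lemma card_le_if_orthonormal:
  assumes u: "orthonormal I J u" and "finite I" "finite J"
  shows "card J \<le> card I"
proof -
  have "real (card J) = (\<Sum>a\<in>J. \<Sum>i\<in>I. (u i a)\<^sup>2)"
    using u by (simp add: power2_eq_square orthonormalD)
  also have "\<dots> = (\<Sum>k\<in>I. \<Sum>a\<in>J. (\<Sum>i\<in>I. (if i = k then 1 else 0) * u i a)\<^sup>2)"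
    using \<open>finite I\<close> by (subst sum.swap) (simp add: if_distrib[of "\<lambda>x. x * _"] cong: if_cong)
  also have "\<dots> \<le> (\<Sum>k\<in>I. \<Sum>i\<in>I. (if i = k then 1 else 0)\<^sup>2)"
    by (intro sum_mono bessel_inequality assms)
  also have "\<dots> = real (card I)" using \<open>finite I\<close> by (simp add: if_distrib[of "\<lambda>x. x\<^sup>2"] cong: if_cong)
  finally show ?thesis by simp
qed

lemma linear_coeff_zero_if_quadratic_nonneg:
  fixes a b :: real
  assumes "\<And>t. 0 \<le> t * a + t\<^sup>2 * b"
  shows "a = 0"
proof (rule ccontr)
  assume "a \<noteq> 0"
  define t where "t = - a / (1 + \<bar>b\<bar>)"
  have "- a / c * a + (- a / c)\<^sup>2 * b = - (a\<^sup>2 / c\<^sup>2) * (c - b)" if "0 < c" for c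
    using that by (simp add: field_simps power2_eq_square)
  from this[of "1 + \<bar>b\<bar>"]
  have "t * a + t\<^sup>2 * b = - (a\<^sup>2 / (1 + \<bar>b\<bar>)\<^sup>2) * (1 + \<bar>b\<bar> - b)"
    by (simp add: t_def)
  moreover have "a\<^sup>2 / (1 + \<bar>b\<bar>)\<^sup>2 * (1 + \<bar>b\<bar> - b) > 0"
    using \<open>a \<noteq> 0\<close> by (intro mult_pos_pos divide_pos_pos) (auto simp: abs_if)
  ultimately show False using assms[of t] by simp
qed

text \<open>
  The squared length of \<open>A y\<close> attains its maximum \<open>m > 0\<close> over the unit sphere at some \<open>v\<close>.
  Perturbing \<open>v\<close> along each coordinate direction shows that \<open>v\<close> is an eigenvector of
  \<open>A\<^sup>T A\<close> for \<open>m\<close>, so that \<open>\<sigma> = sqrt m\<close> and \<open>u = A v / \<sigma>\<close> complete the singular pair.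
\<close>

lemma top_singular_pair:
  fixes A :: "'a \<Rightarrow> 'b \<Rightarrow> real"
  assumes fin: "finite I" "finite J" and nz: "i0 \<in> I" "j0 \<in> J" "A i0 j0 \<noteq> 0"
  obtains u v \<sigma> where "0 < \<sigma>" "(\<Sum>i\<in>I. (u i)\<^sup>2) = 1" "(\<Sum>j\<in>J. (v j)\<^sup>2) = 1"
    "\<And>i. i \<in> I \<Longrightarrow> (\<Sum>j\<in>J. A i j * v j) = \<sigma> * u i"
    "\<And>j. j \<in> J \<Longrightarrow> (\<Sum>i\<in>I. A i j * u i) = \<sigma> * v j"
proof -
  define f where "f y = (\<Sum>i\<in>I. (\<Sum>j\<in>J. A i j * y j)\<^sup>2)" for y :: "'b \<Rightarrow> real"
  define nn where "nn y = (\<Sum>j\<in>J. (y j)\<^sup>2)" for y :: "'b \<Rightarrow> real"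
  \<comment> \<open>The cube \<open>C\<close> contains the sphere and forces the values outside \<open>J\<close> to be \<open>0\<close>; this makes it
    compact in the product topology even when the type \<open>'b\<close> is infinite.\<close>
  define C :: "('b \<Rightarrow> real) set" where "C = (\<Pi>\<^sub>E j\<in>UNIV. if j \<in> J then {-1..1} else {0})"
  have "compactin (product_topology (\<lambda>_. euclidean) UNIV) C"
    unfolding C_def by (subst compactin_PiE) auto
  then have "compact C" by (simp add: euclidean_product_topology)
  moreover have nn_cont: "continuous_on UNIV nn"
    unfolding nn_def by (intro continuous_intros continuous_on_product_coordinates)
  have "closed {y. nn y = 1}"
    by (rule closed_Collect_eq[OF nn_cont continuous_on_const])
  ultimately have comp: "compact (C \<inter> {y. nn y = 1})" by (rule compact_Int_closed)
  define e where "e l = (\<lambda>j. if j = l then 1 else 0 :: real)" for l :: 'b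
  have e_in: "e l \<in> C \<inter> {y. nn y = 1}" if "l \<in> J" for l
    using that fin by (auto simp: C_def e_def nn_def if_distrib[of "\<lambda>x. x\<^sup>2"] cong: if_cong)
  have "continuous_on (C \<inter> {y. nn y = 1}) f"
    unfolding f_def
    by (intro continuous_intros continuous_on_subset[OF continuous_on_product_coordinates]) auto
  then obtain v where v: "v \<in> C" "nn v = 1" and
    vmax: "\<And>y. y \<in> C \<Longrightarrow> nn y = 1 \<Longrightarrow> f y \<le> f v"
    using continuous_attains_sup[OF comp] e_in[OF nz(2)] by blast
  define m where "m = f v"
  have fe: "f (e j0) = (\<Sum>i\<in>I. (A i j0)\<^sup>2)"
    using nz fin by (simp add: f_def e_def if_distrib[of "\<lambda>x. _ * x"] cong: if_cong)
  have "0 < (A i0 j0)\<^sup>2" using nz by simp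
  also have "\<dots> \<le> f (e j0)" unfolding fe by (rule member_le_sum) (use nz fin in auto)
  also have "\<dots> \<le> m" unfolding m_def using e_in[OF nz(2)] by (intro vmax) auto
  finally have m: "0 < m" .
  have fle: "f w \<le> m * nn w" for w
  proof (cases "nn w = 0")
    case True
    then have "\<forall>j\<in>J. w j = 0" using fin by (simp add: nn_def sum_nonneg_eq_0_iff)
    then show ?thesis using True by (simp add: f_def)
  next
    case False
    have nn0: "0 < nn w" using False by (simp add: nn_def sum_nonneg order_less_le)
    define y where "y j = (if j \<in> J then w j / sqrt (nn w) else 0)" for j
    have 1: "nn y = 1" using nn0
      by (simp add: nn_def y_def power_divide sum_divide_distrib[symmetric] sum_nonneg)
    have "\<bar>y j\<bar> \<le> 1" if "j \<in> J" for j
    proof -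
      have "(y j)\<^sup>2 \<le> nn y" unfolding nn_def by (rule member_le_sum) (use that fin in auto)
      then show ?thesis using 1 by (simp add: abs_square_le_1)
    qed
    then have "y j \<in> {-1..1}" if "j \<in> J" for j using that by (simp add: abs_le_iff minus_le_iff)
    moreover have "y j = 0" if "j \<notin> J" for j using that by (simp add: y_def)
    ultimately have "y \<in> C" by (simp add: C_def PiE_iff)
    then have "f y \<le> m" unfolding m_def using 1 by (rule vmax)
    moreover have "f y = f w / nn w"
      using nn0 by (simp add: f_def y_def sum_divide_distrib[symmetric] power_divide)
    ultimately show ?thesis using nn0 by (simp add: field_simps)
  qed
  have stat: "(\<Sum>i\<in>I. A i l * (\<Sum>j\<in>J. A i j * v j)) = m * v l" if l: "l \<in> J" for l
  proof -
    let ?Av = "\<lambda>i. \<Sum>j\<in>J. A i j * v j"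
    have "0 \<le> t * (2 * m * v l - 2 * (\<Sum>i\<in>I. A i l * ?Av i)) + t\<^sup>2 * (m - (\<Sum>i\<in>I. (A i l)\<^sup>2))" for t
    proof -
      let ?w = "\<lambda>j. v j + t * e l j"
      have "f ?w = (\<Sum>i\<in>I. (?Av i + t * A i l)\<^sup>2)"
        using l fin unfolding f_def e_def
        by (simp add: distrib_left sum.distrib if_distrib[of "\<lambda>x. _ * x"] mult_ac cong: if_cong)
      also have "\<dots> = m + 2 * t * (\<Sum>i\<in>I. A i l * ?Av i) + t\<^sup>2 * (\<Sum>i\<in>I. (A i l)\<^sup>2)"
        by (simp add: m_def f_def power2_sum sum.distrib power_mult_distrib sum_distrib_left mult_ac)
      finally have 1: "f ?w = m + 2 * t * (\<Sum>i\<in>I. A i l * ?Av i) + t\<^sup>2 * (\<Sum>i\<in>I. (A i l)\<^sup>2)" .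
      have "nn ?w = nn v + (\<Sum>j\<in>J. if j = l then 2 * t * v j + t\<^sup>2 else 0)"
        unfolding nn_def sum.distrib[symmetric] e_def
        by (intro sum.cong refl) (simp add: power2_sum)
      then have 2: "nn ?w = 1 + 2 * t * v l + t\<^sup>2" using v l fin by simp
      show ?thesis using fle[of ?w] unfolding 1 2 by (simp add: algebra_simps)
    qed
    then have "2 * m * v l - 2 * (\<Sum>i\<in>I. A i l * ?Av i) = 0"
      by (rule linear_coeff_zero_if_quadratic_nonneg)
    then show ?thesis by simp
  qed
  define \<sigma> where "\<sigma> = sqrt m"
  have \<sigma>: "0 < \<sigma>" "\<sigma>\<^sup>2 = m" using m by (auto simp: \<sigma>_def)
  define u where "u i = (\<Sum>j\<in>J. A i j * v j) / \<sigma>" for i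
  show ?thesis
  proof (rule that[of \<sigma> u v])
    have "(\<Sum>i\<in>I. (u i)\<^sup>2) = f v / m"
      by (simp add: u_def f_def power_divide \<sigma> flip: sum_divide_distrib)
    then show "(\<Sum>i\<in>I. (u i)\<^sup>2) = 1" using m by (simp add: m_def)
    show "(\<Sum>i\<in>I. A i j * u i) = \<sigma> * v j" if "j \<in> J" for j
      using stat[OF that] \<sigma>
      by (simp add: u_def sum_divide_distrib[symmetric] field_simps power2_eq_square)
  qed (use \<sigma> v in \<open>auto simp: u_def nn_def\<close>)
qed

text \<open>
  Take an orthonormal system of singular pairs that is as long as possible; its length is
  bounded by \<^term>\<open>card I\<close>. If \<open>A\<close> differed from \<open>\<Sum>\<^sub>k \<sigma>\<^sub>k u\<^sub>k v\<^sub>k\<^sup>T\<close>, then the top singular pair of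
  the difference \<open>A'\<close> would be orthogonal to the system, because \<open>A'\<close> annihilates all \<open>u\<^sub>k\<close>
  and \<open>v\<^sub>k\<close>, and it could be added to the system.
\<close>

lemma singular_value_decomposition:
  fixes A :: "'a \<Rightarrow> 'b \<Rightarrow> real"
  assumes fin: "finite I" "finite J"
  obtains r :: nat and u v \<sigma> where "orthonormal I {..<r} u" "orthonormal J {..<r} v"
    "\<And>k. k < r \<Longrightarrow> 0 < \<sigma> k"
    "\<And>i j. i \<in> I \<Longrightarrow> j \<in> J \<Longrightarrow> A i j = (\<Sum>k<r. \<sigma> k * u i k * v j k)"
    "\<And>k i. k < r \<Longrightarrow> i \<in> I \<Longrightarrow> (\<Sum>j\<in>J. A i j * v j k) = \<sigma> k * u i k"
proof -
  define sys where "sys r u v \<sigma> \<longleftrightarrow> orthonormal I {..<r} u \<and> orthonormal J {..<r} v \<and>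
      (\<forall>k<r. 0 < \<sigma> k \<and> (\<forall>i\<in>I. (\<Sum>j\<in>J. A i j * v j k) = \<sigma> k * u i k) \<and>
        (\<forall>j\<in>J. (\<Sum>i\<in>I. A i j * u i k) = \<sigma> k * v j k))" for r :: nat and u v \<sigma>
  define P where "P r \<longleftrightarrow> (\<exists>u v \<sigma>. sys r u v \<sigma>)" for r
  have "P 0" by (simp add: P_def sys_def orthonormal_def)
  moreover have "\<forall>r. P r \<longrightarrow> r \<le> card I"
    using card_le_if_orthonormal[OF _ fin(1) finite_lessThan] by (auto simp: P_def sys_def)
  ultimately obtain r where "P r" and rmax: "\<And>r'. P r' \<Longrightarrow> r' \<le> r"
    using Nat.ex_has_greatest_nat[of P 0 "card I"] by auto
  then obtain u v \<sigma> where s: "sys r u v \<sigma>" by (auto simp: P_def)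
  then have u: "orthonormal I {..<r} u" and v: "orthonormal J {..<r} v"
    and pos: "\<And>k. k < r \<Longrightarrow> 0 < \<sigma> k"
    and Av: "\<And>k i. k < r \<Longrightarrow> i \<in> I \<Longrightarrow> (\<Sum>j\<in>J. A i j * v j k) = \<sigma> k * u i k"
    and Au: "\<And>k j. k < r \<Longrightarrow> j \<in> J \<Longrightarrow> (\<Sum>i\<in>I. A i j * u i k) = \<sigma> k * v j k"
    by (auto simp: sys_def)
  define A' where "A' i j = A i j - (\<Sum>k<r. \<sigma> k * u i k * v j k)" for i j
  have A'v: "(\<Sum>j\<in>J. A' i j * v j l) = 0" if "i \<in> I" "l < r" for i l
  proof -
    have "(\<Sum>j\<in>J. (\<Sum>k<r. \<sigma> k * u i k * v j k) * v j l)
        = (\<Sum>k<r. \<sigma> k * u i k * (\<Sum>j\<in>J. v j k * v j l))"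
      by (simp add: sum_distrib_left sum_distrib_right mult_ac sum.swap[of _ J])
    also have "\<dots> = \<sigma> l * u i l" using that
      by (simp add: orthonormalD[OF v] if_distrib[of "\<lambda>x. _ * x"] cong: if_cong)
    finally show ?thesis using that by (simp add: A'_def left_diff_distrib sum_subtractf Av)
  qed
  have A'u: "(\<Sum>i\<in>I. A' i j * u i l) = 0" if "j \<in> J" "l < r" for j l
  proof -
    have "(\<Sum>i\<in>I. (\<Sum>k<r. \<sigma> k * u i k * v j k) * u i l)
        = (\<Sum>k<r. \<sigma> k * v j k * (\<Sum>i\<in>I. u i k * u i l))"
      by (simp add: sum_distrib_left sum_distrib_right mult_ac sum.swap[of _ I])
    also have "\<dots> = \<sigma> l * v j l" using that
      by (simp add: orthonormalD[OF u] if_distrib[of "\<lambda>x. _ * x"] cong: if_cong)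
    finally show ?thesis using that by (simp add: A'_def left_diff_distrib sum_subtractf Au)
  qed
  have "A' i j = 0" if ij: "i \<in> I" "j \<in> J" for i j
  proof (rule ccontr)
    assume "A' i j \<noteq> 0"
    obtain x y \<tau> where t: "0 < \<tau>" "(\<Sum>i\<in>I. (x i)\<^sup>2) = 1" "(\<Sum>j\<in>J. (y j)\<^sup>2) = 1"
      and A'y: "\<And>i. i \<in> I \<Longrightarrow> (\<Sum>j\<in>J. A' i j * y j) = \<tau> * x i"
      and A'x: "\<And>j. j \<in> J \<Longrightarrow> (\<Sum>i\<in>I. A' i j * x i) = \<tau> * y j"
      by (rule top_singular_pair[where A = A', OF fin ij \<open>A' i j \<noteq> 0\<close>], rule that, simp_all)
    have xu: "(\<Sum>i\<in>I. x i * u i l) = 0" if "l < r" for l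
    proof -
      have "\<tau> * (\<Sum>i\<in>I. x i * u i l) = (\<Sum>i\<in>I. (\<Sum>j\<in>J. A' i j * y j) * u i l)"
        by (simp add: A'y sum_distrib_left mult.assoc)
      also have "\<dots> = (\<Sum>j\<in>J. y j * (\<Sum>i\<in>I. A' i j * u i l))"
        by (simp add: sum_distrib_left sum_distrib_right mult_ac sum.swap[of _ I])
      finally show ?thesis using A'u that t by simp
    qed
    have yv: "(\<Sum>j\<in>J. y j * v j l) = 0" if "l < r" for l
    proof -
      have "\<tau> * (\<Sum>j\<in>J. y j * v j l) = (\<Sum>j\<in>J. (\<Sum>i\<in>I. A' i j * x i) * v j l)"
        by (simp add: A'x sum_distrib_left mult.assoc)
      also have "\<dots> = (\<Sum>i\<in>I. x i * (\<Sum>j\<in>J. A' i j * v j l))"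
        by (simp add: sum_distrib_left sum_distrib_right mult_ac sum.swap[of _ J])
      finally show ?thesis using A'v that t by simp
    qed
    have Ay: "(\<Sum>j\<in>J. A i j * y j) = \<tau> * x i" if "i \<in> I" for i
    proof -
      have "(\<Sum>j\<in>J. (\<Sum>k<r. \<sigma> k * u i k * v j k) * y j)
          = (\<Sum>k<r. \<sigma> k * u i k * (\<Sum>j\<in>J. y j * v j k))"
        by (simp add: sum_distrib_left sum_distrib_right mult_ac sum.swap[of _ J])
      then show ?thesis using A'y[OF that] yv
        by (simp add: A'_def left_diff_distrib sum_subtractf)
    qed
    have Ax: "(\<Sum>i\<in>I. A i j * x i) = \<tau> * y j" if "j \<in> J" for j
    proof -
      have "(\<Sum>i\<in>I. (\<Sum>k<r. \<sigma> k * u i k * v j k) * x i)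
          = (\<Sum>k<r. \<sigma> k * v j k * (\<Sum>i\<in>I. x i * u i k))"
        by (simp add: sum_distrib_left sum_distrib_right mult_ac sum.swap[of _ I])
      then show ?thesis using A'x[OF that] xu
        by (simp add: A'_def left_diff_distrib sum_subtractf)
    qed
    have "sys (Suc r) (\<lambda>i k. if k = r then x i else u i k) (\<lambda>j k. if k = r then y j else v j k)
        (\<lambda>k. if k = r then \<tau> else \<sigma> k)"
      using u v pos Av Au t xu yv Ax Ay
      by (auto simp: sys_def orthonormal_def less_Suc_eq power2_eq_square mult.commute)
    then have "P (Suc r)" unfolding P_def by blast
    then show False using rmax by fastforce
  qed
  then have A: "A i j = (\<Sum>k<r. \<sigma> k * u i k * v j k)" if "i \<in> I" "j \<in> J" for i j
    using that by (simp add: A'_def)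
  show ?thesis by (rule that[OF u v pos A Av])
qed

section \<open>Leverage scores of matrices\<close>

lemma mat_rank_le_dim_col: "mat_rank A \<le> dim_col A"
  unfolding mat_rank_def by (rule vec_space.rank_le_nc[where nc = "dim_col A"]) simp

lemma mat_rank_orthonormal_cols:
  fixes U :: "real mat"
  assumes UTU: "transpose_mat U * U = 1\<^sub>m (dim_col U)"
  shows "mat_rank U = dim_col U"
proof -
  interpret vec_space "TYPE(real)" "dim_row U" .
  have inner: "col U k \<bullet> col U l = (if k = l then 1 else 0)" if "k < dim_col U" "l < dim_col U" for k l
    using arg_cong[OF UTU, of "\<lambda>M. M $$ (k, l)"] that by simp
  have dist: "distinct (cols U)"
    unfolding distinct_conv_nth
  proof (intro allI impI)
    fix k l assume "k < length (cols U)" "l < length (cols U)" "k \<noteq> l"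
    then show "cols U ! k \<noteq> cols U ! l" using inner[of k l] inner[of k k] by auto
  qed
  have "lin_indpt (set (cols U))"
  proof
    assume "lin_dep (set (cols U))"
    then obtain x where x: "x \<in> carrier_vec (dim_col U)" "x \<noteq> 0\<^sub>v (dim_col U)"
      "U *\<^sub>v x = 0\<^sub>v (dim_row U)"
      using lin_depE[of U "dim_col U"] dist by auto
    have "x = (transpose_mat U * U) *\<^sub>v x" using x by (simp add: UTU)
    also have "\<dots> = transpose_mat U *\<^sub>v (U *\<^sub>v x)"
      using x by (intro assoc_mult_mat_vec) auto
    also have "\<dots> = 0\<^sub>v (dim_col U)" unfolding x(3) by (auto simp: scalar_prod_def)
    finally show False using x by simp
  qed
  then show ?thesis unfolding mat_rank_def
    by (intro lin_indpt_full_rank dist) auto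
qed

text \<open>
  The two factorizations say that the columns of \<open>A\<close> and \<open>U\<close> span the same space.
\<close>

lemma mat_rank_cong_col_space:
  fixes A U :: "real mat"
  assumes dims: "dim_row U = dim_row A" and C: "C \<in> carrier_mat (dim_col U) (dim_col A)"
    and W: "W \<in> carrier_mat (dim_col A) (dim_col U)" and A: "A = U * C" and U: "U = A * W"
  shows "mat_rank A = mat_rank U"
proof -
  interpret vec_space "TYPE(real)" "dim_row A" .
  have cA: "A \<in> carrier_mat (dim_row A) (dim_col A)" by simp
  have cU: "U \<in> carrier_mat (dim_row A) (dim_col U)" using dims by auto
  have AC: "A *\<^sub>v x = U *\<^sub>v (C *\<^sub>v x)" if "x \<in> carrier_vec (dim_col A)" for x
    by (subst A, rule assoc_mult_mat_vec[OF cU C that])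
  have UW: "U *\<^sub>v x = A *\<^sub>v (W *\<^sub>v x)" if "x \<in> carrier_vec (dim_col U)" for x
    by (subst U, rule assoc_mult_mat_vec[OF cA W that])
  have "(\<exists>x\<in>carrier_vec (dim_col A). A *\<^sub>v x = y) \<longleftrightarrow> (\<exists>x\<in>carrier_vec (dim_col U). U *\<^sub>v x = y)" for y
  proof (intro iffI; elim bexE)
    fix x assume x: "x \<in> carrier_vec (dim_col A)" "A *\<^sub>v x = y"
    then have "C *\<^sub>v x \<in> carrier_vec (dim_col U)" "U *\<^sub>v (C *\<^sub>v x) = y"
      using mult_mat_vec_carrier[OF C] AC[OF x(1)] by simp_all
    then show "\<exists>x\<in>carrier_vec (dim_col U). U *\<^sub>v x = y" by blast
  next
    fix x assume x: "x \<in> carrier_vec (dim_col U)" "U *\<^sub>v x = y"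
    then have "W *\<^sub>v x \<in> carrier_vec (dim_col A)" "A *\<^sub>v (W *\<^sub>v x) = y"
      using mult_mat_vec_carrier[OF W] UW[OF x(1)] by simp_all
    then show "\<exists>x\<in>carrier_vec (dim_col A). A *\<^sub>v x = y" by blast
  qed
  then have "col_space A = col_space U"
    unfolding col_space_eq[OF cA] col_space_eq[OF cU] dims by simp
  then show ?thesis by (simp add: mat_rank_def rank_def col_space_def dims)
qed

text \<open>
  Leverage scores are defined through an arbitrary choice of left singular vectors; this
  lemma makes the choice meaningful.
\<close>

lemma left_singular_mat_exists: "\<exists>U. left_singular_mat A U"
proof -
  define K L where "K = dim_row A" and "L = dim_col A"
  have A: "A \<in> carrier_mat K L" unfolding K_def L_def by auto
  obtain r :: nat and u v \<sigma> where u: "orthonormal {..<K} {..<r} u" and v: "orthonormal {..<L} {..<r} v"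
    and \<sigma>: "\<And>k. k < r \<Longrightarrow> 0 < \<sigma> k"
    and Aeq: "\<And>i j. i \<in> {..<K} \<Longrightarrow> j \<in> {..<L} \<Longrightarrow> A $$ (i, j) = (\<Sum>k<r. \<sigma> k * u i k * v j k)"
    and Av: "\<And>k i. k < r \<Longrightarrow> i \<in> {..<K} \<Longrightarrow> (\<Sum>j<L. A $$ (i, j) * v j k) = \<sigma> k * u i k"
    by (rule singular_value_decomposition[where A = "\<lambda>i j. A $$ (i, j)",
          OF finite_lessThan[of K] finite_lessThan[of L]], rule that)
  define U where "U = mat K r (\<lambda>(i, k). u i k)"
  define V where "V = mat L r (\<lambda>(j, k). v j k)"
  define D where "D = mat r r (\<lambda>(k, l). if k = l then \<sigma> k else 0)"
  define W where "W = mat L r (\<lambda>(j, k). v j k / \<sigma> k)"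
  have c: "U \<in> carrier_mat K r" "V \<in> carrier_mat L r" "D \<in> carrier_mat r r" "W \<in> carrier_mat L r"
    by (simp_all add: U_def V_def D_def W_def)
  have UTU: "transpose_mat U * U = 1\<^sub>m r"
    by (rule eq_matI) (use u in \<open>auto simp: U_def scalar_prod_def orthonormalD atLeast0LessThan\<close>)
  have VTV: "transpose_mat V * V = 1\<^sub>m r"
    by (rule eq_matI) (use v in \<open>auto simp: V_def scalar_prod_def orthonormalD atLeast0LessThan\<close>)
  have UD: "U * D = mat K r (\<lambda>(i, k). \<sigma> k * u i k)"
    by (rule eq_matI)
      (auto simp: U_def D_def scalar_prod_def atLeast0LessThan if_distrib[of "\<lambda>x. _ * x"] cong: if_cong)
  have AUDV: "A = U * D * transpose_mat V"
    unfolding UD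
    by (rule eq_matI) (use A in \<open>auto simp: V_def scalar_prod_def atLeast0LessThan Aeq\<close>)
  have UAW: "U = A * W"
  proof (rule eq_matI)
    fix i k assume "i < dim_row (A * W)" "k < dim_col (A * W)"
    then have ik: "i < K" "k < r" using A c by auto
    have "(A * W) $$ (i, k) = (\<Sum>j<L. A $$ (i, j) * v j k) / \<sigma> k"
      using ik A by (simp add: W_def scalar_prod_def atLeast0LessThan sum_divide_distrib)
    then show "U $$ (i, k) = (A * W) $$ (i, k)" using ik \<sigma>[OF ik(2)] by (simp add: Av U_def)
  qed (use A c in auto)
  have dims: "dim_row A = K" "dim_col A = L" "dim_row U = K" "dim_col U = r" using A c by auto
  have "A = U * (D * transpose_mat V)"
    using AUDV c assoc_mult_mat[of U K r D r "transpose_mat V" L] by simp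
  then have "mat_rank A = mat_rank U"
    by (intro mat_rank_cong_col_space[OF _ _ _ _ UAW]) (unfold dims, simp_all add: c mult_carrier_mat[of D r r])
  also have "\<dots> = r" using mat_rank_orthonormal_cols[of U] UTU c by simp
  finally have r: "mat_rank A = r" .
  have "\<exists>V s. V \<in> carrier_mat L r \<and> transpose_mat V * V = 1\<^sub>m r \<and> (\<forall>k<r. 0 < s k) \<and>
      A = U * mat r r (\<lambda>(k, l). if k = l then s k else 0) * transpose_mat V"
    by (rule exI[of _ V], rule exI[of _ \<sigma>], intro conjI allI impI)
      (fact c(2), fact VTV, erule \<sigma>, fact AUDV[unfolded D_def])
  then have "left_singular_mat A U"
    unfolding left_singular_mat_def Let_def r dims by (intro conjI c(1) UTU)
  then show ?thesis ..
qed

text \<open>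
  The comparison of leverage scores works with any orthonormal matrix through which \<open>A\<close>
  factors; the singular values and right singular vectors are absorbed into the second factor.
\<close>

lemma leverage_score_factorization:
  assumes A: "A \<in> carrier_mat K L"
  obtains u c where "orthonormal {..<K} {..<mat_rank A} u"
    "\<And>i j. i < K \<Longrightarrow> j < L \<Longrightarrow> A $$ (i, j) = (\<Sum>k<mat_rank A. u i k * c k j)"
    "\<And>i. leverage_score A i = (\<Sum>k<mat_rank A. (u i k)\<^sup>2)"
proof -
  define r where "r = mat_rank A"
  define U where "U = (SOME U. left_singular_mat A U)"
  have "left_singular_mat A U" unfolding U_def by (rule someI_ex[OF left_singular_mat_exists])
  moreover have "dim_row A = K" "dim_col A = L" using A by auto
  ultimately obtain V s where U: "U \<in> carrier_mat K r" and UTU: "transpose_mat U * U = 1\<^sub>m r"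
    and V: "V \<in> carrier_mat L r"
    and Aeq: "A = U * mat r r (\<lambda>(k, l). if k = l then s k else 0) * transpose_mat V"
    unfolding left_singular_mat_def Let_def r_def[symmetric] by blast
  define D where "D = mat r r (\<lambda>(k, l). if k = l then s k else 0)"
  have D: "D \<in> carrier_mat r r" by (simp add: D_def)
  define C where "C = D * transpose_mat V"
  have C: "C \<in> carrier_mat r L" using D V by (simp add: C_def)
  have "A = U * C" unfolding C_def using U D V Aeq[folded D_def] assoc_mult_mat[of U K r D r "transpose_mat V" L] by simp
  show ?thesis
  proof (rule that[of "\<lambda>i k. U $$ (i, k)" "\<lambda>k j. C $$ (k, j)"])
    have "(\<Sum>i<K. U $$ (i, a) * U $$ (i, b)) = (if a = b then 1 else 0)" if "a < r" "b < r" for a b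
      using arg_cong[OF UTU, of "\<lambda>M. M $$ (a, b)"] that U
      by (simp add: scalar_prod_def atLeast0LessThan)
    then show "orthonormal {..<K} {..<mat_rank A} (\<lambda>i k. U $$ (i, k))"
      by (simp add: orthonormal_def r_def)
    show "A $$ (i, j) = (\<Sum>k<mat_rank A. U $$ (i, k) * C $$ (k, j))" if "i < K" "j < L" for i j
      unfolding r_def[symmetric] using that U C
      by (subst \<open>A = U * C\<close>) (simp add: scalar_prod_def atLeast0LessThan)
    show "leverage_score A i = (\<Sum>k<mat_rank A. (U $$ (i, k))\<^sup>2)" for i
      using U by (simp add: leverage_score_def U_def[symmetric] Let_def r_def)
  qed
qed

section \<open>Leverage scores of subchain unfoldings\<close>

text \<open>
  Leverage scores are monotone in the column space. If \<open>A = W M\<close> with \<open>W\<close> orthonormal, and \<open>u\<close>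
  is orthonormal with columns in the column space of \<open>A\<close>, then \<open>u = W N\<close> where \<open>N\<close> has
  orthonormal columns as well; the rows of \<open>u\<close> are therefore no longer than those of \<open>W\<close>, by
  Bessel's inequality for \<open>N\<close>.
\<close>

lemma leverage_le_if_col_space_subset:
  fixes A :: "'a \<Rightarrow> 'b \<Rightarrow> real" and W :: "'a \<Rightarrow> 'c \<Rightarrow> real"
  assumes W: "orthonormal I \<Lambda> W" "finite \<Lambda>" and u: "orthonormal I J u" "finite J"
    and AW: "\<And>a c. a \<in> I \<Longrightarrow> c \<in> C \<Longrightarrow> A a c = (\<Sum>\<kappa>\<in>\<Lambda>. W a \<kappa> * M \<kappa> c)"
    and uA: "\<And>a k. a \<in> I \<Longrightarrow> k \<in> J \<Longrightarrow> u a k = (\<Sum>c\<in>C. A a c * T c k)"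
    and a: "a \<in> I"
  shows "(\<Sum>k\<in>J. (u a k)\<^sup>2) \<le> (\<Sum>\<kappa>\<in>\<Lambda>. (W a \<kappa>)\<^sup>2)"
proof -
  define N where "N \<kappa> k = (\<Sum>c\<in>C. M \<kappa> c * T c k)" for \<kappa> k
  have uN: "u a k = (\<Sum>\<kappa>\<in>\<Lambda>. W a \<kappa> * N \<kappa> k)" if "a \<in> I" "k \<in> J" for a k
  proof -
    have "u a k = (\<Sum>c\<in>C. \<Sum>\<kappa>\<in>\<Lambda>. W a \<kappa> * (M \<kappa> c * T c k))"
      using that by (simp add: uA AW sum_distrib_left sum_distrib_right mult_ac)
    then show ?thesis unfolding N_def by (simp add: sum_distrib_left sum.swap[of _ C])
  qed
  have "(\<Sum>\<kappa>\<in>\<Lambda>. N \<kappa> k * N \<kappa> l) = (if k = l then 1 else 0)" if "k \<in> J" "l \<in> J" for k l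
  proof -
    have "(\<Sum>\<kappa>\<in>\<Lambda>. N \<kappa> k * N \<kappa> l) = (\<Sum>a\<in>I. u a k * u a l)"
      using orthonormal_inner[OF W, of "\<lambda>\<kappa>. N \<kappa> k" "\<lambda>\<kappa>. N \<kappa> l"] that by (simp add: uN)
    then show ?thesis using u that by (simp add: orthonormalD)
  qed
  then have N: "orthonormal \<Lambda> J N" by (simp add: orthonormal_def)
  have "(\<Sum>k\<in>J. (u a k)\<^sup>2) = (\<Sum>k\<in>J. (\<Sum>\<kappa>\<in>\<Lambda>. W a \<kappa> * N \<kappa> k)\<^sup>2)"
    using a by (simp add: uN)
  also have "\<dots> \<le> (\<Sum>\<kappa>\<in>\<Lambda>. (W a \<kappa>)\<^sup>2)" by (rule bessel_inequality[OF N u(2)])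
  finally show ?thesis .
qed

text \<open>
  Decoding the row index of a subchain unfolding is a bijection. The inverse \<open>\<psi>\<close> is the
  multi-index of the tuple, padded by \<open>0\<close> at the mode \<open>n\<close> that the subchain omits. It is injective
  since decoding undoes it, and surjective since both sets have the same size.
\<close>

lemma split_index_enumeration:
  assumes n: "n < N" and I: "\<And>j. j < N \<Longrightarrow> 0 < I j"
  obtains \<psi> where "bij_betw \<psi> (\<Pi>\<^sub>E j\<in>{..<N} - {n}. {..<I j}) {..<\<Prod>j\<in>{..<N} - {n}. I j}"
    "\<And>i j. i \<in> (\<Pi>\<^sub>E j\<in>{..<N} - {n}. {..<I j}) \<Longrightarrow> j \<in> {..<N} - {n} \<Longrightarrow>
       split_index N I n (\<psi> i) ! j = i j"
proof -
  define E where "E = {..<N} - {n}"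
  define ds where "ds = map I [0..<N]"
  define lst where "lst i = map (\<lambda>j. if j = n then 0 else i j) [0..<N]" for i :: "nat \<Rightarrow> nat"
  define \<psi> where "\<psi> i = multi_index (cyc_others n ds) (cyc_others n (lst i))" for i
  have lst: "lst i \<in> indices ds" if "i \<in> (\<Pi>\<^sub>E j\<in>E. {..<I j})" for i
    using that I unfolding indices_def lst_def ds_def
    by (auto simp: list_all2_conv_all_nth E_def PiE_iff)
  have split: "split_index N I n (\<psi> i) ! j = i j" if "i \<in> (\<Pi>\<^sub>E j\<in>E. {..<I j})" "j \<in> E" for i j
    using split_index_multi_index[of "lst i" I N n j] lst[OF that(1)] that(2) n
    by (simp add: \<psi>_def ds_def E_def) (simp add: lst_def)
  have "\<psi> i < (\<Prod>j\<in>E. I j)" if "i \<in> (\<Pi>\<^sub>E j\<in>E. {..<I j})" for i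
  proof -
    have "\<psi> i < prod_list (cyc_others n ds)"
      unfolding \<psi>_def using others_indices(2)[OF lst[OF that]] by (simp add: indices_def multi_index_less)
    also have "\<dots> = (\<Prod>j\<in>E. I j)" using n by (auto simp: ds_def others_prod E_def intro!: prod.cong)
    finally show ?thesis .
  qed
  then have sub: "\<psi> ` (\<Pi>\<^sub>E j\<in>E. {..<I j}) \<subseteq> {..<\<Prod>j\<in>E. I j}" by auto
  have inj: "inj_on \<psi> (\<Pi>\<^sub>E j\<in>E. {..<I j})"
    by (rule inj_onI) (metis PiE_ext split)
  have "card (\<psi> ` (\<Pi>\<^sub>E j\<in>E. {..<I j})) = (\<Prod>j\<in>E. I j)"
    by (subst card_image[OF inj]) (simp add: card_PiE E_def)
  then have "\<psi> ` (\<Pi>\<^sub>E j\<in>E. {..<I j}) = {..<\<Prod>j\<in>E. I j}"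
    using sub by (intro card_subset_eq) auto
  then show ?thesis using inj split that[of \<psi>] by (auto simp: bij_betw_def E_def)
qed

lemma split_index_less:
  assumes "n < N" "\<And>j. j < N \<Longrightarrow> 0 < I j" "a < (\<Prod>j\<in>{..<N} - {n}. I j)" "j \<in> {..<N} - {n}"
  shows "split_index N I n a ! j < I j"
proof -
  obtain \<psi> where b: "bij_betw \<psi> (\<Pi>\<^sub>E j\<in>{..<N} - {n}. {..<I j}) {..<\<Prod>j\<in>{..<N} - {n}. I j}"
    and s: "\<And>i j. i \<in> (\<Pi>\<^sub>E j\<in>{..<N} - {n}. {..<I j}) \<Longrightarrow> j \<in> {..<N} - {n} \<Longrightarrow>
       split_index N I n (\<psi> i) ! j = i j"
    by (rule split_index_enumeration[of n N I, OF assms(1,2)], assumption, rule that)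
  obtain i where "i \<in> (\<Pi>\<^sub>E j\<in>{..<N} - {n}. {..<I j})" "a = \<psi> i"
    using b assms(3) unfolding bij_betw_def by blast
  then show ?thesis using s[of i j] assms(4) by (auto simp: PiE_iff)
qed

lemma sum_prod_split_index:
  fixes f :: "nat \<Rightarrow> nat \<Rightarrow> 'a :: comm_semiring_1"
  assumes "n < N" "\<And>j. j < N \<Longrightarrow> 0 < I j"
  shows "(\<Sum>a<\<Prod>j\<in>{..<N} - {n}. I j. \<Prod>j\<in>{..<N} - {n}. f j (split_index N I n a ! j))
       = (\<Prod>j\<in>{..<N} - {n}. \<Sum>i<I j. f j i)"
proof -
  obtain \<psi> where b: "bij_betw \<psi> (\<Pi>\<^sub>E j\<in>{..<N} - {n}. {..<I j}) {..<\<Prod>j\<in>{..<N} - {n}. I j}"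
    and s: "\<And>i j. i \<in> (\<Pi>\<^sub>E j\<in>{..<N} - {n}. {..<I j}) \<Longrightarrow> j \<in> {..<N} - {n} \<Longrightarrow>
       split_index N I n (\<psi> i) ! j = i j"
    by (rule split_index_enumeration[of n N I, OF assms], assumption, rule that)
  show ?thesis
    by (subst sum.reindex_bij_betw[OF b, symmetric], subst prod_sum_PiE)
      (auto intro!: sum.cong prod.cong simp: s)
qed

text \<open>
  Summing over the rows of the Kronecker product is summing over all index tuples, so the
  inner product of two columns is the product over the modes of inner products of columns of
  the factors.
\<close>

lemma orthonormal_kronecker:
  assumes "n < N" "\<And>j. j < N \<Longrightarrow> 0 < I j"
    and u: "\<And>j. j < N \<Longrightarrow> orthonormal {..<I j} {..<\<rho> j} (u j)"
  shows "orthonormal {..<\<Prod>j\<in>{..<N} - {n}. I j} (\<Pi>\<^sub>E j\<in>{..<N} - {n}. {..<\<rho> j})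
     (\<lambda>a \<kappa>. \<Prod>j\<in>{..<N} - {n}. u j (split_index N I n a ! j) (\<kappa> j))"
  unfolding orthonormal_def
proof (intro ballI)
  let ?E = "{..<N} - {n}"
  fix \<kappa> \<mu> assume k: "\<kappa> \<in> (\<Pi>\<^sub>E j\<in>?E. {..<\<rho> j})" "\<mu> \<in> (\<Pi>\<^sub>E j\<in>?E. {..<\<rho> j})"
  have "(\<Sum>a<\<Prod>j\<in>?E. I j. (\<Prod>j\<in>?E. u j (split_index N I n a ! j) (\<kappa> j)) *
        (\<Prod>j\<in>?E. u j (split_index N I n a ! j) (\<mu> j)))
     = (\<Prod>j\<in>?E. \<Sum>i<I j. u j i (\<kappa> j) * u j i (\<mu> j))"
    unfolding prod.distrib[symmetric] by (rule sum_prod_split_index[OF assms(1,2)])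
  also have "\<dots> = (\<Prod>j\<in>?E. if \<kappa> j = \<mu> j then 1 else 0)"
    using k by (intro prod.cong refl orthonormalD[OF u]) (auto simp: PiE_iff)
  also have "\<dots> = (if \<kappa> = \<mu> then 1 else 0)"
  proof (cases "\<kappa> = \<mu>")
    case False
    then obtain j where "j \<in> ?E" "\<kappa> j \<noteq> \<mu> j" using k PiE_ext by metis
    then show ?thesis using False by (auto intro!: prod_zero)
  qed simp
  finally show "(\<Sum>a<\<Prod>j\<in>?E. I j. (\<Prod>j\<in>?E. u j (split_index N I n a ! j) (\<kappa> j)) *
        (\<Prod>j\<in>?E. u j (split_index N I n a ! j) (\<mu> j))) = (if \<kappa> = \<mu> then 1 else 0)" .
qed

lemma two_others_of_three: "{..<Suc (Suc (Suc 0))} - {Suc 0} = {0, Suc (Suc 0)}"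
  by auto

lemma unfold_classical_core:
  "unfold_classical [P, Q, R] 1 T = mat Q (P * R) (\<lambda>(a, b). T [b mod P, a, b div P mod R])"
  by (simp add: unfold_classical_def others_def insert_at_def two_others_of_three eval_nat_numeral)

lemma unfold_cyclic_subchain:
  "unfold_cyclic [P, Q, R] 1 T = mat Q (P * R) (\<lambda>(a, b). T [b div R mod P, a, b mod R])"
  by (simp add: unfold_cyclic_def cyc_others_def cyc_insert_at_def two_others_of_three eval_nat_numeral)

lemma subchain_unfolding_entry:
  assumes "n < N" "a < (\<Prod>j\<in>{..<N} - {n}. I j)" "b < R n * R (cpred N n)"
  shows "unfold_cyclic (subchain_dims N I R n) 1 (subchain N I R G n) $$ (a, b) =
    (\<Sum>r\<in>{r \<in> Pi\<^sub>E {..<N} (\<lambda>j. {..<R j}). r n = b div R (cpred N n) \<and> r (cpred N n) = b mod R (cpred N n)}.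
       \<Prod>j\<in>{..<N} - {n}. G j [r (cpred N j), split_index N I n a ! j, r j])"
proof -
  have 1: "b div R (cpred N n) < R n" "b mod R (cpred N n) < R (cpred N n)"
    using assms(3) by (simp_all add: less_mult_imp_div_less) (metis gr0I less_nat_zero_code mult_0_right mod_less_divisor)
  then show ?thesis using assms
    by (simp add: subchain_dims_def unfold_cyclic_subchain[unfolded One_nat_def] subchain_def indices_def)
qed

lemma mixed_radix_less:
  fixes x y m n :: nat
  assumes "x < m" "y < n"
  shows "x + m * y < m * n"
proof -
  have "x + m * y < m * Suc y" using assms by simp
  also have "\<dots> \<le> m * n" using assms by (intro mult_left_mono) auto
  finally show ?thesis .
qed

lemma cpred_less: "0 < N \<Longrightarrow> cpred N j < N" by (simp add: cpred_def)

text \<open>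
  This is why products of core leverage scores are a good sampling distribution. The column
  space of the subchain unfolding lies inside the Kronecker product of the column spaces of
  the core unfoldings: expanding each core in its left singular vectors and exchanging the
  product with the sums factors the Kronecker product \<open>W\<close> out of every entry. The squared
  row lengths of \<open>W\<close> are products of core leverage scores, and these are the sampling
  probabilities times the ranks, which are at most \<open>R\<^sub>j\<^sub>-\<^sub>1 R\<^sub>j\<close>.
\<close>

lemma subchain_leverage_le:
  fixes I R :: "nat \<Rightarrow> nat" and G :: "nat \<Rightarrow> tensor" and u T :: "nat \<Rightarrow> nat \<Rightarrow> real"
  assumes n: "n < N" and I: "\<And>j. j < N \<Longrightarrow> 0 < I j"
  defines "K \<equiv> \<Prod>j\<in>{..<N} - {n}. I j"
    and "A \<equiv> unfold_cyclic (subchain_dims N I R n) 1 (subchain N I R G n)"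
  assumes u: "orthonormal {..<K} {..<r} u"
    and uA: "\<And>a k. a < K \<Longrightarrow> k < r \<Longrightarrow> u a k = (\<Sum>c<R n * R (cpred N n). A $$ (a, c) * T c k)"
    and a: "a < K"
  shows "(\<Sum>k<r. (u a k)\<^sup>2)
    \<le> (\<Prod>j\<in>{..<N} - {n}. real (R (cpred N j)) * real (R j)) * subchain_prob N I R G n a"
proof -
  define E where "E = {..<N} - {n}"
  define B where "B j = unfold_classical (core_dims N I R j) 1 (G j)" for j
  define \<rho> where "\<rho> j = mat_rank (B j)" for j
  have B: "B j \<in> carrier_mat (I j) (R (cpred N j) * R j)" for j
    by (simp add: B_def core_dims_def unfold_classical_core[unfolded One_nat_def])
  have Bentry: "B j $$ (i, x + R (cpred N j) * y) = G j [x, i, y]"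
    if "j < N" "i < I j" "x < R (cpred N j)" "y < R j" for i j x y
  proof -
    have "x + R (cpred N j) * y < R (cpred N j) * R j"
      using that by (intro mixed_radix_less)
    then show ?thesis using that
      by (simp add: B_def core_dims_def unfold_classical_core[unfolded One_nat_def])
  qed
  have "\<forall>j. \<exists>w c. orthonormal {..<I j} {..<\<rho> j} w \<and>
     (\<forall>i<I j. \<forall>l<R (cpred N j) * R j. B j $$ (i, l) = (\<Sum>k<\<rho> j. w i k * c k l)) \<and>
     (\<forall>i. leverage_score (B j) i = (\<Sum>k<\<rho> j. (w i k)\<^sup>2))"
  proof
    fix j
    show "\<exists>w c. orthonormal {..<I j} {..<\<rho> j} w \<and>
     (\<forall>i<I j. \<forall>l<R (cpred N j) * R j. B j $$ (i, l) = (\<Sum>k<\<rho> j. w i k * c k l)) \<and>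
     (\<forall>i. leverage_score (B j) i = (\<Sum>k<\<rho> j. (w i k)\<^sup>2))"
      unfolding \<rho>_def by (rule leverage_score_factorization[OF B[of j]]) blast
  qed
  from choice[OF this] obtain w where "\<forall>j. \<exists>c. orthonormal {..<I j} {..<\<rho> j} (w j) \<and>
     (\<forall>i<I j. \<forall>l<R (cpred N j) * R j. B j $$ (i, l) = (\<Sum>k<\<rho> j. w j i k * c k l)) \<and>
     (\<forall>i. leverage_score (B j) i = (\<Sum>k<\<rho> j. (w j i k)\<^sup>2))" ..
  from choice[OF this] obtain c where wc: "\<forall>j. orthonormal {..<I j} {..<\<rho> j} (w j) \<and>
     (\<forall>i<I j. \<forall>l<R (cpred N j) * R j. B j $$ (i, l) = (\<Sum>k<\<rho> j. w j i k * c j k l)) \<and>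
     (\<forall>i. leverage_score (B j) i = (\<Sum>k<\<rho> j. (w j i k)\<^sup>2))" ..
  have w: "\<And>j. orthonormal {..<I j} {..<\<rho> j} (w j)"
    and Bw: "\<And>j i l. i < I j \<Longrightarrow> l < R (cpred N j) * R j \<Longrightarrow> B j $$ (i, l) = (\<Sum>k<\<rho> j. w j i k * c j k l)"
    and lev: "\<And>j i. leverage_score (B j) i = (\<Sum>k<\<rho> j. (w j i k)\<^sup>2)"
    using wc by simp_all
  define W where "W a \<kappa> = (\<Prod>j\<in>E. w j (split_index N I n a ! j) (\<kappa> j))" for a \<kappa>
  define \<Lambda> where "\<Lambda> = (\<Pi>\<^sub>E j\<in>E. {..<\<rho> j})"
  have fin: "finite \<Lambda>" by (simp add: \<Lambda>_def E_def finite_PiE)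
  have W: "orthonormal {..<K} \<Lambda> W"
    unfolding W_def \<Lambda>_def E_def K_def by (rule orthonormal_kronecker[OF n I w])
  define P where "P b = {r \<in> Pi\<^sub>E {..<N} (\<lambda>j. {..<R j}). r n = b div R (cpred N n) \<and>
      r (cpred N n) = b mod R (cpred N n)}" for b
  define M where "M \<kappa> b = (\<Sum>r\<in>P b. \<Prod>j\<in>E. c j (\<kappa> j) (r (cpred N j) + R (cpred N j) * r j))" for \<kappa> b
  have AW: "A $$ (a, b) = (\<Sum>\<kappa>\<in>\<Lambda>. W a \<kappa> * M \<kappa> b)" if "a < K" "b < R n * R (cpred N n)" for a b
  proof -
    have "A $$ (a, b) = (\<Sum>r\<in>P b. \<Prod>j\<in>E. G j [r (cpred N j), split_index N I n a ! j, r j])"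
      unfolding A_def P_def E_def using n that
      by (intro subchain_unfolding_entry) (auto simp: K_def)
    also have "\<dots> = (\<Sum>r\<in>P b. \<Prod>j\<in>E. \<Sum>k<\<rho> j. w j (split_index N I n a ! j) k *
        c j k (r (cpred N j) + R (cpred N j) * r j))"
    proof (intro sum.cong prod.cong refl)
      fix r j assume r: "r \<in> P b" and j: "j \<in> E"
      have jN: "j < N" "cpred N j < N" using j n by (auto simp: E_def cpred_less)
      have i: "split_index N I n a ! j < I j"
        using split_index_less[OF n I] that(1) j by (simp add: K_def E_def)
      have rj: "r (cpred N j) < R (cpred N j)" "r j < R j" using r jN by (auto simp: P_def PiE_iff)
      have "r (cpred N j) + R (cpred N j) * r j < R (cpred N j) * R j"
        using rj by (intro mixed_radix_less)
      then show "G j [r (cpred N j), split_index N I n a ! j, r j] = (\<Sum>k<\<rho> j. w j (split_index N I n a ! j) k *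
        c j k (r (cpred N j) + R (cpred N j) * r j))"
        using Bentry[OF jN(1) i rj] Bw[OF i] by simp
    qed
    also have "\<dots> = (\<Sum>r\<in>P b. \<Sum>\<kappa>\<in>\<Lambda>. W a \<kappa> * (\<Prod>j\<in>E. c j (\<kappa> j) (r (cpred N j) + R (cpred N j) * r j)))"
      unfolding \<Lambda>_def W_def prod.distrib[symmetric]
      by (intro sum.cong refl prod_sum_PiE) (auto simp: E_def)
    also have "\<dots> = (\<Sum>\<kappa>\<in>\<Lambda>. W a \<kappa> * M \<kappa> b)"
      unfolding M_def by (simp add: sum_distrib_left sum.swap[of _ "P b"])
    finally show ?thesis .
  qed
  have "(\<Sum>k<r. (u a k)\<^sup>2) \<le> (\<Sum>\<kappa>\<in>\<Lambda>. (W a \<kappa>)\<^sup>2)"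
    by (rule leverage_le_if_col_space_subset[where A = "\<lambda>a b. A $$ (a, b)" and I = "{..<K}"
          and C = "{..<R n * R (cpred N n)}" and T = T and M = M])
      (use W fin u AW uA a in auto)
  also have "\<dots> = (\<Prod>j\<in>E. \<Sum>k<\<rho> j. (w j (split_index N I n a ! j) k)\<^sup>2)"
    unfolding W_def \<Lambda>_def prod_power_distrib by (subst prod_sum_PiE) (auto simp: E_def)
  also have "\<dots> = (\<Prod>j\<in>E. leverage_score (B j) (split_index N I n a ! j))" by (simp add: lev)
  also have "\<dots> = (\<Prod>j\<in>E. real (\<rho> j) * core_prob N I R G j (split_index N I n a ! j))"
  proof (intro prod.cong refl)
    fix j
    show "leverage_score (B j) (split_index N I n a ! j)
        = real (\<rho> j) * core_prob N I R G j (split_index N I n a ! j)"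
      \<comment> \<open>For rank \<open>0\<close> the leverage score is an empty sum, so the division by \<open>0\<close> is harmless.\<close>
      using lev[of j] by (cases "\<rho> j = 0") (simp_all add: core_prob_def Let_def B_def \<rho>_def)
  qed
  also have "\<dots> \<le> (\<Prod>j\<in>E. real (R (cpred N j)) * real (R j) * core_prob N I R G j (split_index N I n a ! j))"
  proof (intro prod_mono conjI mult_right_mono)
    fix j
    have p: "0 \<le> core_prob N I R G j (split_index N I n a ! j)"
      using lev[of j] by (simp add: core_prob_def Let_def B_def \<rho>_def sum_nonneg)
    then show "0 \<le> core_prob N I R G j (split_index N I n a ! j)" .
    show "0 \<le> real (\<rho> j) * core_prob N I R G j (split_index N I n a ! j)" using p by simp
    have "\<rho> j \<le> R (cpred N j) * R j" using mat_rank_le_dim_col[of "B j"] B[of j] by (simp add: \<rho>_def)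
    then show "real (\<rho> j) \<le> real (R (cpred N j)) * real (R j)"
      unfolding of_nat_mult[symmetric] by (rule of_nat_mono)
  qed
  finally show ?thesis by (simp add: prod.distrib subchain_prob_def E_def)
qed

section \<open>Weighted least squares\<close>

text \<open>
  The squared Frobenius distance between \<open>u\<^sup>T diag(s) u\<close> and the identity, where \<open>s\<close> stands
  for the weights on the diagonal of \<open>S\<^sup>T S\<close>.
\<close>

definition gram_error :: "'a set \<Rightarrow> 'b set \<Rightarrow> ('a \<Rightarrow> 'b \<Rightarrow> real) \<Rightarrow> ('a \<Rightarrow> real) \<Rightarrow> real" where
  "gram_error I J u s =
     (\<Sum>a\<in>J. \<Sum>b\<in>J. ((\<Sum>i\<in>I. s i * (u i a * u i b)) - (if a = b then 1 else 0))\<^sup>2)"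

text \<open>
  The squared Frobenius norm of \<open>u\<^sup>T diag(s) b\<close>.
\<close>

definition cross_term ::
  "'a set \<Rightarrow> 'b set \<Rightarrow> 'c set \<Rightarrow> ('a \<Rightarrow> 'b \<Rightarrow> real) \<Rightarrow> ('a \<Rightarrow> 'c \<Rightarrow> real) \<Rightarrow> ('a \<Rightarrow> real) \<Rightarrow> real" where
  "cross_term I J C u b s = (\<Sum>a\<in>J. \<Sum>c\<in>C. (\<Sum>i\<in>I. s i * (u i a * b i c))\<^sup>2)"

lemma sum_mult_le_sqrt:
  fixes f g :: "'a \<Rightarrow> real"
  shows "(\<Sum>i\<in>A. f i * g i) \<le> sqrt (\<Sum>i\<in>A. (f i)\<^sup>2) * sqrt (\<Sum>i\<in>A. (g i)\<^sup>2)"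
  unfolding real_sqrt_mult[symmetric] by (rule real_le_rsqrt) (rule Cauchy_Schwarz_ineq_sum)

lemma sum2_mult_le_sqrt:
  fixes f g :: "'a \<Rightarrow> 'b \<Rightarrow> real"
  shows "(\<Sum>i\<in>A. \<Sum>j\<in>B. f i j * g i j)
    \<le> sqrt (\<Sum>i\<in>A. \<Sum>j\<in>B. (f i j)\<^sup>2) * sqrt (\<Sum>i\<in>A. \<Sum>j\<in>B. (g i j)\<^sup>2)"
  using sum_mult_le_sqrt[of "\<lambda>(i, j). f i j" "\<lambda>(i, j). g i j" "A \<times> B"]
  by (simp add: sum.cartesian_product case_prod_unfold)

text \<open>
  Write \<open>e = u Y\<close>. Testing the normal equations of the weighted problem only with the error
  \<open>e\<close> itself gives \<open>\<langle>Y, (u\<^sup>T diag(s) u) Y\<rangle> = \<langle>Y, u\<^sup>T diag(s) b\<rangle>\<close>. The left side is at least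
  \<open>(1 - sqrt gram_error) |Y|\<^sup>2\<close> and the right side is at most \<open>|Y| sqrt cross_term\<close>, both by the
  Cauchy-Schwarz inequality.
\<close>

lemma coordinate_error_bound:
  fixes u :: "'a \<Rightarrow> 'b \<Rightarrow> real" and Y :: "'b \<Rightarrow> 'c \<Rightarrow> real"
  assumes J: "finite J"
  defines "e \<equiv> \<lambda>i c. \<Sum>a\<in>J. u i a * Y a c"
  assumes normal: "(\<Sum>i\<in>I. s i * (\<Sum>c\<in>C. (e i c - b i c) * e i c)) = 0"
  shows "(1 - sqrt (gram_error I J u s)) * sqrt (\<Sum>a\<in>J. \<Sum>c\<in>C. (Y a c)\<^sup>2)
    \<le> sqrt (cross_term I J C u b s)"
proof -
  define nY where "nY = (\<Sum>a\<in>J. \<Sum>c\<in>C. (Y a c)\<^sup>2)"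
  define \<Phi> where "\<Phi> a a' = (\<Sum>i\<in>I. s i * (u i a * u i a')) - (if a = a' then 1 else 0)" for a a'
  define YY where "YY a a' = (\<Sum>c\<in>C. Y a c * Y a' c)" for a a'
  have nY0: "0 \<le> nY" by (simp add: nY_def sum_nonneg)
  have "(\<Sum>i\<in>I. s i * (\<Sum>c\<in>C. e i c * e i c)) = (\<Sum>i\<in>I. s i * (\<Sum>c\<in>C. b i c * e i c))"
    using normal by (simp add: left_diff_distrib sum_subtractf right_diff_distrib)
  also have "\<dots> = (\<Sum>i\<in>I. \<Sum>c\<in>C. \<Sum>a\<in>J. Y a c * (s i * (u i a * b i c)))"
    unfolding e_def by (simp add: sum_distrib_left mult_ac)
  also have "\<dots> = (\<Sum>a\<in>J. \<Sum>c\<in>C. Y a c * (\<Sum>i\<in>I. s i * (u i a * b i c)))"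
    unfolding sum_distrib_left by (simp only: sum.swap[of _ C J] sum.swap[of _ I J] sum.swap[of _ I C])
  also have "\<dots> \<le> sqrt nY * sqrt (cross_term I J C u b s)"
    unfolding nY_def cross_term_def by (rule sum2_mult_le_sqrt)
  finally have upper: "(\<Sum>i\<in>I. s i * (\<Sum>c\<in>C. e i c * e i c))
    \<le> sqrt nY * sqrt (cross_term I J C u b s)" .
  have "(\<Sum>i\<in>I. s i * (\<Sum>c\<in>C. e i c * e i c))
      = (\<Sum>i\<in>I. \<Sum>c\<in>C. \<Sum>a\<in>J. \<Sum>a'\<in>J. s i * (u i a * u i a') * (Y a c * Y a' c))"
    unfolding e_def sum_product by (simp add: sum_distrib_left mult_ac)
  also have "\<dots> = (\<Sum>a\<in>J. \<Sum>a'\<in>J. \<Sum>i\<in>I. \<Sum>c\<in>C. s i * (u i a * u i a') * (Y a c * Y a' c))"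
    by (simp only: sum.swap[of _ C J] sum.swap[of _ I J])
  also have "\<dots> = (\<Sum>a\<in>J. \<Sum>a'\<in>J. (\<Phi> a a' + (if a = a' then 1 else 0)) * YY a a')"
    by (simp add: \<Phi>_def YY_def sum_product)
  also have "\<dots> = (\<Sum>a\<in>J. \<Sum>a'\<in>J. \<Phi> a a' * YY a a') + nY"
    using J by (simp add: distrib_right sum.distrib nY_def YY_def power2_eq_square
        if_distrib[of "\<lambda>x. x * _"] cong: if_cong)
  finally have lower: "(\<Sum>i\<in>I. s i * (\<Sum>c\<in>C. e i c * e i c))
    = (\<Sum>a\<in>J. \<Sum>a'\<in>J. \<Phi> a a' * YY a a') + nY" .
  have "(\<Sum>a\<in>J. \<Sum>a'\<in>J. (YY a a')\<^sup>2)
      \<le> (\<Sum>a\<in>J. \<Sum>a'\<in>J. (\<Sum>c\<in>C. (Y a c)\<^sup>2) * (\<Sum>c\<in>C. (Y a' c)\<^sup>2))"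
    unfolding YY_def by (intro sum_mono Cauchy_Schwarz_ineq_sum)
  also have "\<dots> = nY\<^sup>2" by (simp add: nY_def power2_eq_square sum_product)
  finally have YY: "sqrt (\<Sum>a\<in>J. \<Sum>a'\<in>J. (YY a a')\<^sup>2) \<le> nY"
    using nY0 by (intro real_le_lsqrt) (auto intro!: sum_nonneg)
  have "- (\<Sum>a\<in>J. \<Sum>a'\<in>J. \<Phi> a a' * YY a a') = (\<Sum>a\<in>J. \<Sum>a'\<in>J. - \<Phi> a a' * YY a a')"
    by (simp add: sum_negf)
  also have "\<dots> \<le> sqrt (\<Sum>a\<in>J. \<Sum>a'\<in>J. (- \<Phi> a a')\<^sup>2) * sqrt (\<Sum>a\<in>J. \<Sum>a'\<in>J. (YY a a')\<^sup>2)"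
    by (rule sum2_mult_le_sqrt)
  also have "\<dots> = sqrt (gram_error I J u s) * sqrt (\<Sum>a\<in>J. \<Sum>a'\<in>J. (YY a a')\<^sup>2)"
    by (simp only: gram_error_def \<Phi>_def power2_minus)
  also have "\<dots> \<le> sqrt (gram_error I J u s) * nY"
    using YY by (intro mult_left_mono) (auto simp: gram_error_def intro!: sum_nonneg)
  finally have "nY - sqrt (gram_error I J u s) * nY \<le> sqrt nY * sqrt (cross_term I J C u b s)"
    using upper lower by linarith
  moreover have "sqrt nY * ((1 - sqrt (gram_error I J u s)) * sqrt nY)
      = (1 - sqrt (gram_error I J u s)) * (sqrt nY * sqrt nY)" by (simp only: mult_ac)
  ultimately have main: "sqrt nY * ((1 - sqrt (gram_error I J u s)) * sqrt nY)
      \<le> sqrt nY * sqrt (cross_term I J C u b s)"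
    using nY0 by (simp add: left_diff_distrib)
  have "(1 - sqrt (gram_error I J u s)) * sqrt nY \<le> sqrt (cross_term I J C u b s)"
  proof (cases "nY = 0")
    case True
    then show ?thesis by (simp add: cross_term_def sum_nonneg)
  next
    case False
    then show ?thesis using main nY0 by (subst (asm) mult_le_cancel_left_pos) auto
  qed
  then show ?thesis by (simp add: nY_def)
qed

text \<open>
  The combination of \<open>\<phi>\<close> and \<open>g\<close> in the hypothesis is linear, so that its expectation is easy
  to bound. With \<open>\<gamma> = g / (2 \<epsilon> \<rho>)\<close> it still yields \<open>sqrt \<phi> + sqrt \<gamma> < 1\<close>, since
  \<open>(sqrt \<phi> + sqrt \<gamma>)\<^sup>2 \<le> 2 \<phi> + 2 \<gamma>\<close>; hence \<open>sqrt \<gamma> \<le> 1 - sqrt \<phi>\<close>, and the factor \<open>1 - sqrt \<phi>\<close>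
  cancels. If \<open>\<rho> = 0\<close> the quotients are \<open>0\<close> by convention, which the last hypothesis matches.
\<close>

lemma coordinate_error_small:
  fixes \<phi> g y \<rho> \<epsilon> :: real
  assumes bound: "(1 - sqrt \<phi>) * sqrt y \<le> sqrt g" and small: "2 * \<phi> + g / (\<epsilon> * \<rho>) < 1"
    and nn: "0 \<le> \<phi>" "0 \<le> g" "0 \<le> \<rho>" "0 < \<epsilon>" and deg: "\<rho> = 0 \<Longrightarrow> g = 0"
  shows "y \<le> 2 * \<epsilon> * \<rho>"
proof -
  define \<gamma> where "\<gamma> = g / (2 * \<epsilon> * \<rho>)"
  have \<gamma>: "0 \<le> \<gamma>" "g = \<gamma> * (2 * \<epsilon> * \<rho>)" "2 * \<phi> + 2 * \<gamma> < 1"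
    using nn deg small by (auto simp: \<gamma>_def)
  have "0 \<le> (sqrt \<phi> - sqrt \<gamma>)\<^sup>2" by simp
  then have "(sqrt \<phi> + sqrt \<gamma>)\<^sup>2 \<le> 2 * \<phi> + 2 * \<gamma>"
    using nn \<gamma> by (simp add: power2_sum power2_diff)
  then have "(sqrt \<phi> + sqrt \<gamma>)\<^sup>2 < 1\<^sup>2" using \<gamma> by simp
  then have sum: "sqrt \<phi> + sqrt \<gamma> < 1" by (rule power2_less_imp_less) simp
  have "(1 - sqrt \<phi>) * sqrt y \<le> sqrt \<gamma> * sqrt (2 * \<epsilon> * \<rho>)"
    using bound \<gamma>(2) by (simp add: real_sqrt_mult)
  also have "\<dots> \<le> (1 - sqrt \<phi>) * sqrt (2 * \<epsilon> * \<rho>)"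
    using sum nn by (intro mult_right_mono) auto
  finally have "sqrt y \<le> sqrt (2 * \<epsilon> * \<rho>)" using sum \<gamma>(1)
    by (subst (asm) mult_le_cancel_left_pos) (use real_sqrt_ge_zero[OF \<gamma>(1)] in linarith)+
  then show ?thesis by simp
qed

lemma orthonormal_residual:
  assumes u: "orthonormal I J u" and J: "finite J" and k: "k \<in> J"
  shows "(\<Sum>i\<in>I. u i k * (w i - (\<Sum>l\<in>J. u i l * (\<Sum>i\<in>I. u i l * w i)))) = 0"
proof -
  define p where "p k = (\<Sum>i\<in>I. u i k * w i)" for k
  have "(\<Sum>i\<in>I. u i k * (\<Sum>l\<in>J. u i l * p l)) = (\<Sum>l\<in>J. p l * (\<Sum>i\<in>I. u i k * u i l))"
    by (simp add: sum_distrib_left mult_ac sum.swap[of _ I])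
  also have "\<dots> = p k"
    using k J by (simp add: orthonormalD[OF u] if_distrib[of "\<lambda>x. _ * x"] cong: if_cong)
  finally show ?thesis by (simp add: p_def right_diff_distrib sum_subtractf)
qed

text \<open>
  Deterministic analysis of the sketch. Here \<open>u\<close> is an orthonormal basis of the column space
  of \<open>A\<close>, and \<open>b\<close> is the part of \<open>B\<close> orthogonal to that space. The residual of any \<open>Z\<close> is
  \<open>e - b\<close> with \<open>e = u y\<close> in the column space, so Pythagoras' theorem gives the lower bound and
  reduces the upper bound to an estimate of the coordinates \<open>y\<close>. If \<open>Z\<close> minimizes the weighted
  problem, then moving it along \<open>- T y\<close> changes the residual along \<open>- e\<close>, and the first
  order condition in that direction is the one required by \<open>coordinate_error_bound\<close>.
\<close>

lemma sketched_least_squares: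
  fixes A :: "'a \<Rightarrow> 'b \<Rightarrow> real" and B :: "'a \<Rightarrow> 'c \<Rightarrow> real" and s :: "'a \<Rightarrow> real"
    and u :: "'a \<Rightarrow> 'd \<Rightarrow> real"
  assumes J: "finite J" and u: "orthonormal I J u"
    and Au: "\<And>i l. i \<in> I \<Longrightarrow> l \<in> L \<Longrightarrow> A i l = (\<Sum>k\<in>J. u i k * D k l)"
    and uA: "\<And>i k. i \<in> I \<Longrightarrow> k \<in> J \<Longrightarrow> u i k = (\<Sum>l\<in>L. A i l * T l k)"
  defines "E \<equiv> \<lambda>Z i c. (\<Sum>l\<in>L. A i l * Z l c) - B i c"
    and "b \<equiv> \<lambda>i c. B i c - (\<Sum>k\<in>J. u i k * (\<Sum>i\<in>I. u i k * B i c))"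
  shows sketched_least_squares_lower: "\<And>Z. (\<Sum>i\<in>I. \<Sum>c\<in>C. (b i c)\<^sup>2) \<le> (\<Sum>i\<in>I. \<Sum>c\<in>C. (E Z i c)\<^sup>2)"
    and sketched_least_squares_upper: "\<And>Z. finite I \<Longrightarrow> finite C \<Longrightarrow> 0 < \<epsilon> \<Longrightarrow>
      (\<And>Z'. (\<Sum>i\<in>I. s i * (\<Sum>c\<in>C. (E Z i c)\<^sup>2)) \<le> (\<Sum>i\<in>I. s i * (\<Sum>c\<in>C. (E Z' i c)\<^sup>2))) \<Longrightarrow>
      2 * gram_error I J u s + cross_term I J C u b s / (\<epsilon> * (\<Sum>i\<in>I. \<Sum>c\<in>C. (b i c)\<^sup>2)) < 1 \<Longrightarrow>
      (\<Sum>i\<in>I. \<Sum>c\<in>C. (E Z i c)\<^sup>2) \<le> (1 + 2 * \<epsilon>) * (\<Sum>i\<in>I. \<Sum>c\<in>C. (b i c)\<^sup>2)"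
proof -
  define y where "y Z k c = (\<Sum>l\<in>L. D k l * Z l c) - (\<Sum>i\<in>I. u i k * B i c)" for Z k c
  define e where "e Z i c = (\<Sum>k\<in>J. u i k * y Z k c)" for Z i c
  have E: "E Z i c = e Z i c - b i c" if "i \<in> I" for Z i c
  proof -
    have "(\<Sum>l\<in>L. A i l * Z l c) = (\<Sum>k\<in>J. u i k * (\<Sum>l\<in>L. D k l * Z l c))"
      using that by (simp add: Au sum_distrib_left sum_distrib_right mult_ac sum.swap[of _ L])
    then show ?thesis
      by (simp add: E_def e_def b_def y_def right_diff_distrib sum_subtractf)
  qed
  have ub: "(\<Sum>i\<in>I. u i k * b i c) = 0" if "k \<in> J" for k c
    unfolding b_def by (rule orthonormal_residual[OF u J that])
  have eb: "(\<Sum>i\<in>I. e Z i c * b i c) = 0" for Z c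
  proof -
    have "(\<Sum>i\<in>I. e Z i c * b i c) = (\<Sum>k\<in>J. y Z k c * (\<Sum>i\<in>I. u i k * b i c))"
      unfolding e_def by (simp add: sum_distrib_left sum_distrib_right mult_ac sum.swap[of _ I])
    then show ?thesis by (simp add: ub)
  qed
  have "(\<Sum>i\<in>I. (E Z i c)\<^sup>2) = (\<Sum>k\<in>J. (y Z k c)\<^sup>2) + (\<Sum>i\<in>I. (b i c)\<^sup>2)" for Z c
  proof -
    have "(\<Sum>i\<in>I. (E Z i c)\<^sup>2) = (\<Sum>i\<in>I. (e Z i c)\<^sup>2 + (b i c)\<^sup>2 - 2 * (e Z i c * b i c))"
      by (intro sum.cong refl) (simp add: E power2_diff)
    also have "\<dots> = (\<Sum>i\<in>I. (e Z i c)\<^sup>2) + (\<Sum>i\<in>I. (b i c)\<^sup>2)"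
      using eb[of Z c] by (simp add: sum_subtractf sum.distrib flip: sum_distrib_left)
    finally show ?thesis unfolding e_def orthonormal_norm[OF u J] .
  qed
  then have pyth: "(\<Sum>i\<in>I. \<Sum>c\<in>C. (E Z i c)\<^sup>2)
      = (\<Sum>k\<in>J. \<Sum>c\<in>C. (y Z k c)\<^sup>2) + (\<Sum>i\<in>I. \<Sum>c\<in>C. (b i c)\<^sup>2)" for Z
    unfolding sum.swap[of "\<lambda>i c. (E Z i c)\<^sup>2"] sum.swap[of "\<lambda>i c. (b i c)\<^sup>2"]
      sum.swap[of "\<lambda>k c. (y Z k c)\<^sup>2"] by (simp add: sum.distrib)
  show "(\<Sum>i\<in>I. \<Sum>c\<in>C. (b i c)\<^sup>2) \<le> (\<Sum>i\<in>I. \<Sum>c\<in>C. (E Z i c)\<^sup>2)" for Z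
    unfolding pyth by (simp add: sum_nonneg)
  fix Z
  assume I: "finite I" and C: "finite C" and \<epsilon>: "0 < \<epsilon>"
  assume min: "(\<Sum>i\<in>I. s i * (\<Sum>c\<in>C. (E Z i c)\<^sup>2)) \<le> (\<Sum>i\<in>I. s i * (\<Sum>c\<in>C. (E Z' i c)\<^sup>2))" for Z'
  assume small: "2 * gram_error I J u s + cross_term I J C u b s / (\<epsilon> * (\<Sum>i\<in>I. \<Sum>c\<in>C. (b i c)\<^sup>2)) < 1"
  have "0 \<le> t * (- 2 * (\<Sum>i\<in>I. s i * (\<Sum>c\<in>C. (e Z i c - b i c) * e Z i c)))
      + t\<^sup>2 * (\<Sum>i\<in>I. s i * (\<Sum>c\<in>C. (e Z i c)\<^sup>2))" for t
  proof -
    define Z' where "Z' l c = Z l c - t * (\<Sum>k\<in>J. T l k * y Z k c)" for l c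
    have E': "E Z' i c = (e Z i c - b i c) - t * e Z i c" if "i \<in> I" for i c
    proof -
      have "(\<Sum>l\<in>L. A i l * (t * (\<Sum>k\<in>J. T l k * y Z k c))) = t * (\<Sum>k\<in>J. (\<Sum>l\<in>L. A i l * T l k) * y Z k c)"
        by (simp add: sum_distrib_left sum_distrib_right mult_ac sum.swap[of _ L])
      also have "\<dots> = t * e Z i c" using that by (simp add: e_def uA)
      finally have "E Z' i c = E Z i c - t * e Z i c"
        by (simp add: E_def Z'_def right_diff_distrib sum_subtractf)
      then show ?thesis using that by (simp add: E)
    qed
    have "(\<Sum>i\<in>I. s i * (\<Sum>c\<in>C. (E Z' i c)\<^sup>2)) = (\<Sum>i\<in>I. s i * (\<Sum>c\<in>C. (E Z i c)\<^sup>2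
        + t * (- 2 * ((e Z i c - b i c) * e Z i c)) + t\<^sup>2 * (e Z i c)\<^sup>2))"
      by (intro sum.cong refl arg_cong2[where f = "(*)"])
        (subst E', assumption, subst E, assumption, simp add: power2_eq_square algebra_simps)
    also have "\<dots> = (\<Sum>i\<in>I. s i * (\<Sum>c\<in>C. (E Z i c)\<^sup>2))
        + t * (- 2 * (\<Sum>i\<in>I. s i * (\<Sum>c\<in>C. (e Z i c - b i c) * e Z i c)))
        + t\<^sup>2 * (\<Sum>i\<in>I. s i * (\<Sum>c\<in>C. (e Z i c)\<^sup>2))"
      by (simp add: sum.distrib distrib_left right_diff_distrib sum_subtractf sum_negf sum_distrib_left mult_ac)
    finally show ?thesis using min[of Z'] by linarith
  qed
  then have "- 2 * (\<Sum>i\<in>I. s i * (\<Sum>c\<in>C. (e Z i c - b i c) * e Z i c)) = 0"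
    by (rule linear_coeff_zero_if_quadratic_nonneg)
  then have normal: "(\<Sum>i\<in>I. s i * (\<Sum>c\<in>C. (e Z i c - b i c) * e Z i c)) = 0" by simp
  have "(\<Sum>k\<in>J. \<Sum>c\<in>C. (y Z k c)\<^sup>2) \<le> 2 * \<epsilon> * (\<Sum>i\<in>I. \<Sum>c\<in>C. (b i c)\<^sup>2)"
  proof (rule coordinate_error_small[OF coordinate_error_bound small])
    show "(\<Sum>i\<in>I. s i * (\<Sum>c\<in>C. ((\<Sum>a\<in>J. u i a * y Z a c) - b i c) * (\<Sum>a\<in>J. u i a * y Z a c))) = 0"
      using normal by (simp add: e_def)
    show "cross_term I J C u b s = 0" if "(\<Sum>i\<in>I. \<Sum>c\<in>C. (b i c)\<^sup>2) = 0"
    proof -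
      have "\<forall>i\<in>I. \<forall>c\<in>C. b i c = 0"
        using that I C by (simp add: sum_nonneg_eq_0_iff sum_nonneg)
      then show ?thesis by (simp add: cross_term_def)
    qed
  qed (use J \<epsilon> in \<open>auto simp: gram_error_def cross_term_def intro!: sum_nonneg\<close>)
  then show "(\<Sum>i\<in>I. \<Sum>c\<in>C. (E Z i c)\<^sup>2) \<le> (1 + 2 * \<epsilon>) * (\<Sum>i\<in>I. \<Sum>c\<in>C. (b i c)\<^sup>2)"
    unfolding pyth by (simp add: algebra_simps)
qed

section \<open>Row sampling\<close>

text \<open>
  The \<open>i\<close>th diagonal entry of \<open>S\<^sup>T S\<close> when the sampled rows are \<open>x 0, \<dots>, x (J - 1)\<close>.
\<close>

definition sample_weight :: "nat \<Rightarrow> (nat \<Rightarrow> real) \<Rightarrow> (nat \<Rightarrow> nat) \<Rightarrow> nat \<Rightarrow> real" where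
  "sample_weight J q x i = (\<Sum>j<J. if x j = i then 1 / (real J * q i) else 0)"

lemma sum_sample_weight:
  assumes "\<And>j. j < J \<Longrightarrow> x j < K"
  shows "(\<Sum>i<K. sample_weight J q x i * f i) = (\<Sum>j<J. f (x j) / (real J * q (x j)))"
proof -
  have "(\<Sum>i<K. sample_weight J q x i * f i)
      = (\<Sum>j<J. \<Sum>i<K. if x j = i then f i / (real J * q i) else 0)"
    unfolding sample_weight_def sum_distrib_right
    by (subst sum.swap) (auto intro!: sum.cong)
  also have "\<dots> = (\<Sum>j<J. f (x j) / (real J * q (x j)))"
    using assms by (intro sum.cong refl) simp
  finally show ?thesis .
qed

locale iid_sampling = prob_space M for M :: "'w measure" +
  fixes J K :: nat and q :: "nat \<Rightarrow> real" and v :: "nat \<Rightarrow> 'w \<Rightarrow> nat"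
  assumes indep: "indep_vars (\<lambda>_. count_space {..<K}) v {..<J}"
    and distr: "\<And>j i. j < J \<Longrightarrow> i < K \<Longrightarrow> prob {w \<in> space M. v j w = i} = q i"
begin

lemma v_measurable: "j < J \<Longrightarrow> v j \<in> M \<rightarrow>\<^sub>M count_space {..<K}"
  using indep by (auto simp: indep_vars_def)

lemma v_less: "j < J \<Longrightarrow> w \<in> space M \<Longrightarrow> v j w < K"
  using measurable_space[OF v_measurable] by auto

text \<open>
  The sample is treated as one random element of a finite set. Every event and every real
  function that depends on the sample alone is then measurable and integrable, no matter
  how complicated it is.
\<close>

lemma sample_measurable:
  "(\<lambda>w. \<lambda>j\<in>{..<J}. v j w) \<in> M \<rightarrow>\<^sub>M count_space ({..<J} \<rightarrow>\<^sub>E {..<K})"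
proof (subst measurable_count_space_eq2)
  show "finite ({..<J} \<rightarrow>\<^sub>E {..<K})" by (simp add: finite_PiE)
  have "(\<lambda>w. \<lambda>j\<in>{..<J}. v j w) -` {x} \<inter> space M \<in> sets M" if x: "x \<in> {..<J} \<rightarrow>\<^sub>E {..<K}" for x
  proof -
    have "(\<lambda>w. \<lambda>j\<in>{..<J}. v j w) -` {x} \<inter> space M = {w \<in> space M. \<forall>j\<in>{..<J}. v j w = x j}"
      using x by (auto simp: fun_eq_iff restrict_def PiE_iff extensional_def)
    also have "\<dots> \<in> sets M"
    proof (intro sets.sets_Collect_finite_All finite_lessThan)
      fix j assume "j \<in> {..<J}"
      then have "v j -` {x j} \<inter> space M \<in> sets M"
        using x by (intro measurable_sets[OF v_measurable]) auto
      moreover have "v j -` {x j} \<inter> space M = {w \<in> space M. v j w = x j}" by auto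
      ultimately show "{w \<in> space M. v j w = x j} \<in> sets M" by simp
    qed
    finally show ?thesis .
  qed
  then show "(\<lambda>w. \<lambda>j\<in>{..<J}. v j w) \<in> space M \<rightarrow> {..<J} \<rightarrow>\<^sub>E {..<K} \<and>
      (\<forall>x\<in>{..<J} \<rightarrow>\<^sub>E {..<K}. (\<lambda>w. \<lambda>j\<in>{..<J}. v j w) -` {x} \<inter> space M \<in> sets M)"
    using v_less by auto
qed

lemma sample_event: "{w \<in> space M. P (\<lambda>j\<in>{..<J}. v j w)} \<in> sets M"
proof -
  have "{w \<in> space M. P (\<lambda>j\<in>{..<J}. v j w)}
      = (\<lambda>w. \<lambda>j\<in>{..<J}. v j w) -` {x \<in> {..<J} \<rightarrow>\<^sub>E {..<K}. P x} \<inter> space M"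
    using measurable_space[OF sample_measurable] by auto
  also have "\<dots> \<in> sets M" by (rule measurable_sets[OF sample_measurable]) auto
  finally show ?thesis .
qed

lemma sample_integrable:
  fixes f :: "(nat \<Rightarrow> nat) \<Rightarrow> real"
  shows "integrable M (\<lambda>w. f (\<lambda>j\<in>{..<J}. v j w))"
proof (rule integrable_const_bound)
  show "AE w in M. norm (f (\<lambda>j\<in>{..<J}. v j w)) \<le> (\<Sum>x\<in>{..<J} \<rightarrow>\<^sub>E {..<K}. \<bar>f x\<bar>)"
  proof (rule AE_I2)
    fix w assume "w \<in> space M"
    then have "(\<lambda>j\<in>{..<J}. v j w) \<in> {..<J} \<rightarrow>\<^sub>E {..<K}"
      using measurable_space[OF sample_measurable] by auto
    then show "norm (f (\<lambda>j\<in>{..<J}. v j w)) \<le> (\<Sum>x\<in>{..<J} \<rightarrow>\<^sub>E {..<K}. \<bar>f x\<bar>)"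
      unfolding real_norm_def
      by (intro member_le_sum[where f = "\<lambda>x. \<bar>f x\<bar>"]) (auto simp: finite_PiE)
  qed
  show "(\<lambda>w. f (\<lambda>j\<in>{..<J}. v j w)) \<in> borel_measurable M"
    by (rule measurable_compose[OF sample_measurable]) simp
qed

lemma integrable_coordinate: "j < J \<Longrightarrow> integrable M (\<lambda>w. h (v j w) :: real)"
  using sample_integrable[of "\<lambda>x. h (x j)"] by simp

lemma expectation_coordinate:
  fixes h :: "nat \<Rightarrow> real"
  assumes j: "j < J"
  shows "expectation (\<lambda>w. h (v j w)) = (\<Sum>i<K. q i * h i)"
proof -
  have ev: "{w \<in> space M. v j w = i} \<in> events" for i
    using sample_event[of "\<lambda>x. x j = i"] j by simp
  have "expectation (\<lambda>w. h (v j w))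
      = expectation (\<lambda>w. \<Sum>i<K. h i * indicator {w \<in> space M. v j w = i} w)"
  proof (rule Bochner_Integration.integral_cong[OF refl])
    fix w assume w: "w \<in> space M"
    have "(\<Sum>i<K. h i * indicator {w \<in> space M. v j w = i} w)
        = (\<Sum>i<K. if v j w = i then h i else 0)"
      using w by (intro sum.cong refl) (simp add: indicator_def)
    then show "h (v j w) = (\<Sum>i<K. h i * indicator {w \<in> space M. v j w = i} w)"
      using v_less[OF j w] by simp
  qed
  also have "\<dots> = (\<Sum>i<K. h i * prob {w \<in> space M. v j w = i})"
    by (subst Bochner_Integration.integral_sum)
      (use ev in \<open>auto simp: emeasure_eq_measure intro!: integrable_mult_right integrable_real_indicator\<close>)
  also have "\<dots> = (\<Sum>i<K. q i * h i)" using j by (intro sum.cong refl) (simp add: distr)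
  finally show ?thesis .
qed

lemma expectation_product_centred:
  assumes jk: "j < J" "k < J" "j \<noteq> k" and h: "(\<Sum>i<K. q i * h i) = (0::real)"
  shows "expectation (\<lambda>w. h (v j w) * h (v k w)) = 0"
proof -
  have "indep_vars (\<lambda>_. count_space {..<K}) v {j, k}"
    using jk by (intro indep_vars_subset[OF indep]) auto
  then have "indep_vars (\<lambda>_. borel) (\<lambda>j w. h (v j w)) {j, k}"
    by (rule indep_vars_compose2) simp
  then have "expectation (\<lambda>w. \<Prod>i\<in>{j, k}. h (v i w)) = (\<Prod>i\<in>{j, k}. expectation (\<lambda>w. h (v i w)))"
    using jk integrable_coordinate by (intro indep_vars_lebesgue_integral) auto
  then show ?thesis using jk h by (simp add: expectation_coordinate)
qed

lemma q_nonneg: "0 < J \<Longrightarrow> i < K \<Longrightarrow> 0 \<le> q i"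
  using distr[of 0 i] measure_nonneg by metis

lemma q_sum: "0 < J \<Longrightarrow> (\<Sum>i<K. q i) = 1"
  using expectation_coordinate[of 0 "\<lambda>_. 1"] prob_space by simp

text \<open>
  The weighted sum is the mean of the \<open>J\<close> independent values \<open>f (v\<^sub>j) / q (v\<^sub>j)\<close>. Each has
  expectation \<open>\<Sum> f\<close>, for which \<open>f\<close> has to vanish where \<open>q\<close> does. The mean square error is
  therefore the variance of one of them over \<open>J\<close>, and the variance is at most the second moment.
\<close>

lemma sample_mean_square_error:
  assumes J: "0 < J" and f: "\<And>i. i < K \<Longrightarrow> q i = 0 \<Longrightarrow> f i = 0"
  shows "expectation (\<lambda>w. ((\<Sum>i<K. sample_weight J q (\<lambda>j\<in>{..<J}. v j w) i * f i) - (\<Sum>i<K. f i))\<^sup>2)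
    \<le> (\<Sum>i<K. (f i)\<^sup>2 / q i) / real J"
proof -
  define \<mu> where "\<mu> = (\<Sum>i<K. f i)"
  define h where "h i = f i / q i - \<mu>" for i
  have qf: "(\<Sum>i<K. q i * (f i / q i)) = \<mu>"
    unfolding \<mu>_def using f by (intro sum.cong refl) auto
  have h0: "(\<Sum>i<K. q i * h i) = 0"
    unfolding h_def right_diff_distrib sum_subtractf qf
    by (simp add: q_sum[OF J] flip: sum_distrib_right)
  have "(\<Sum>i<K. q i * (h i)\<^sup>2)
      = (\<Sum>i<K. q i * (f i / q i)\<^sup>2 - 2 * \<mu> * (q i * (f i / q i)) + \<mu>\<^sup>2 * q i)"
    unfolding h_def by (intro sum.cong refl) (simp add: power2_diff algebra_simps)
  also have "\<dots> = (\<Sum>i<K. q i * (f i / q i)\<^sup>2) - \<mu>\<^sup>2"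
    unfolding sum.distrib sum_subtractf sum_distrib_left[symmetric] qf q_sum[OF J]
    by (simp add: power2_eq_square)
  also have "\<dots> \<le> (\<Sum>i<K. q i * (f i / q i)\<^sup>2)" by simp
  also have "\<dots> = (\<Sum>i<K. (f i)\<^sup>2 / q i)"
    by (intro sum.cong refl) (simp add: power2_eq_square)
  finally have h2: "(\<Sum>i<K. q i * (h i)\<^sup>2) \<le> (\<Sum>i<K. (f i)\<^sup>2 / q i)" .
  have int: "integrable M (\<lambda>w. h (v j w) * h (v k w))" if "j < J" "k < J" for j k
    using sample_integrable[of "\<lambda>x. h (x j) * h (x k)"] that by simp
  have "expectation (\<lambda>w. ((\<Sum>i<K. sample_weight J q (\<lambda>j\<in>{..<J}. v j w) i * f i) - \<mu>)\<^sup>2)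
      = expectation (\<lambda>w. (\<Sum>j<J. \<Sum>k<J. h (v j w) * h (v k w)) / (real J)\<^sup>2)"
  proof (rule Bochner_Integration.integral_cong[OF refl])
    fix w assume w: "w \<in> space M"
    have "(\<Sum>i<K. sample_weight J q (\<lambda>j\<in>{..<J}. v j w) i * f i)
        = (\<Sum>j<J. f (v j w) / (real J * q (v j w)))"
      by (subst sum_sample_weight) (use v_less w in auto)
    also have "\<dots> = (\<Sum>j<J. (h (v j w) + \<mu>) / real J)"
      by (intro sum.cong refl) (simp add: h_def)
    also have "\<dots> = (\<Sum>j<J. h (v j w)) / real J + \<mu>"
      using J by (simp add: add_divide_distrib sum.distrib sum_divide_distrib)
    finally show "((\<Sum>i<K. sample_weight J q (\<lambda>j\<in>{..<J}. v j w) i * f i) - \<mu>)\<^sup>2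
      = (\<Sum>j<J. \<Sum>k<J. h (v j w) * h (v k w)) / (real J)\<^sup>2"
      by (simp add: power_divide power2_eq_square[of "sum _ _"] sum_product)
  qed
  also have "\<dots> = (\<Sum>j<J. \<Sum>k<J. expectation (\<lambda>w. h (v j w) * h (v k w))) / (real J)\<^sup>2"
  proof -
    have "expectation (\<lambda>w. \<Sum>j<J. \<Sum>k<J. h (v j w) * h (v k w))
        = (\<Sum>j<J. expectation (\<lambda>w. \<Sum>k<J. h (v j w) * h (v k w)))"
      by (intro Bochner_Integration.integral_sum Bochner_Integration.integrable_sum int) auto
    also have "\<dots> = (\<Sum>j<J. \<Sum>k<J. expectation (\<lambda>w. h (v j w) * h (v k w)))"
      by (intro sum.cong refl Bochner_Integration.integral_sum int) auto
    finally show ?thesis by simp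
  qed
  also have "(\<Sum>j<J. \<Sum>k<J. expectation (\<lambda>w. h (v j w) * h (v k w)))
      = (\<Sum>j<J. \<Sum>k<J. if j = k then (\<Sum>i<K. q i * (h i)\<^sup>2) else 0)"
  proof (intro sum.cong refl)
    fix j k assume jk: "j \<in> {..<J}" "k \<in> {..<J}"
    show "expectation (\<lambda>w. h (v j w) * h (v k w)) = (if j = k then \<Sum>i<K. q i * (h i)\<^sup>2 else 0)"
      using jk expectation_product_centred[of j k h, OF _ _ _ h0]
        expectation_coordinate[of j "\<lambda>i. (h i)\<^sup>2"] by (auto simp: power2_eq_square)
  qed
  also have "\<dots> = real J * (\<Sum>i<K. q i * (h i)\<^sup>2)" by simp
  also have "\<dots> / (real J)\<^sup>2 = (\<Sum>i<K. q i * (h i)\<^sup>2) / real J"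
    using J by (simp add: power2_eq_square)
  also have "\<dots> \<le> (\<Sum>i<K. (f i)\<^sup>2 / q i) / real J" using h2 by (rule divide_right_mono) simp
  finally show ?thesis unfolding \<mu>_def .
qed

end

section \<open>Random sketches of least squares problems\<close>

context iid_sampling
begin

text \<open>
  Both quantities are sums of mean square errors of single entries. Adding the variance
  bounds of all entries leaves the sum over \<open>i\<close> of the squared row length of \<open>u\<close>, divided by
  \<open>q\<^sub>i\<close>, times the squared row length of \<open>u\<close> or \<open>b\<close>. The first two factors give at most \<open>D\<close>.
\<close>

lemma
  fixes u :: "nat \<Rightarrow> nat \<Rightarrow> real" and r :: nat
  assumes J: "0 < J" and u: "orthonormal {..<K} {..<r} u"
    and D: "0 \<le> D" "\<And>i. i < K \<Longrightarrow> (\<Sum>a<r. (u i a)\<^sup>2) \<le> D * q i"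
  shows expectation_gram_error_le:
      "expectation (\<lambda>w. gram_error {..<K} {..<r} u (sample_weight J q (\<lambda>j\<in>{..<J}. v j w)))
        \<le> D * real r / real J" (is ?gram)
    and expectation_cross_term_le:
      "(\<And>a c. a < r \<Longrightarrow> c \<in> C \<Longrightarrow> (\<Sum>i<K. u i a * b i c) = 0) \<Longrightarrow>
        expectation (\<lambda>w. cross_term {..<K} {..<r} C u b (sample_weight J q (\<lambda>j\<in>{..<J}. v j w)))
        \<le> D * (\<Sum>i<K. \<Sum>c\<in>C. (b i c)\<^sup>2) / real J"
proof -
  let ?s = "\<lambda>w. sample_weight J q (\<lambda>j\<in>{..<J}. v j w)"
  have u0: "u i a = 0" if "i < K" "q i = 0" "a < r" for i a
  proof -
    have "(u i a)\<^sup>2 \<le> (\<Sum>a<r. (u i a)\<^sup>2)" by (rule member_le_sum) (use that in auto)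
    also have "\<dots> \<le> 0" using D(2)[OF that(1)] that(2) by simp
    finally show ?thesis by simp
  qed
  have lev: "(\<Sum>a<r. (u i a)\<^sup>2) * t / q i \<le> D * t" if "i < K" "0 \<le> t" for i and t :: real
  proof (cases "q i = 0")
    case False
    then have "0 < q i" using q_nonneg[OF J that(1)] by simp
    then show ?thesis using mult_right_mono[OF D(2)[OF that(1)] that(2)]
      by (simp add: field_simps)
  qed (use D that in simp)
  have int: "integrable M (\<lambda>w. ((\<Sum>i<K. ?s w i * f i) - m)\<^sup>2)" for f :: "nat \<Rightarrow> real" and m
    by (rule sample_integrable[of "\<lambda>x. ((\<Sum>i<K. sample_weight J q x i * f i) - m)\<^sup>2"])
  have int0: "integrable M (\<lambda>w. (\<Sum>i<K. ?s w i * f i)\<^sup>2)" for f :: "nat \<Rightarrow> real"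
    using int[of f 0] by simp
  have "expectation (\<lambda>w. gram_error {..<K} {..<r} u (?s w))
      = (\<Sum>a<r. \<Sum>b<r. expectation (\<lambda>w. ((\<Sum>i<K. ?s w i * (u i a * u i b)) - (if a = b then 1 else 0))\<^sup>2))"
    unfolding gram_error_def
    by (simp only: Bochner_Integration.integral_sum Bochner_Integration.integrable_sum int)
  also have "\<dots> \<le> (\<Sum>a<r. \<Sum>b<r. (\<Sum>i<K. (u i a * u i b)\<^sup>2 / q i) / real J)"
  proof (intro sum_mono)
    fix a b assume ab: "a \<in> {..<r}" "b \<in> {..<r}"
    have "(if a = b then 1 else 0) = (\<Sum>i<K. u i a * u i b)" using orthonormalD[OF u ab] by simp
    then show "expectation (\<lambda>w. ((\<Sum>i<K. ?s w i * (u i a * u i b)) - (if a = b then 1 else 0))\<^sup>2)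
        \<le> (\<Sum>i<K. (u i a * u i b)\<^sup>2 / q i) / real J"
      using sample_mean_square_error[OF J, of "\<lambda>i. u i a * u i b"] u0 ab by simp
  qed
  also have "\<dots> = (\<Sum>i<K. (\<Sum>a<r. (u i a)\<^sup>2) * (\<Sum>b<r. (u i b)\<^sup>2) / q i) / real J"
    unfolding sum_divide_distrib[symmetric] sum_product power_mult_distrib
    by (subst sum.swap[of _ "{..<K}"], subst sum.swap[of _ "{..<K}"]) (simp add: sum_divide_distrib)
  also have "\<dots> \<le> (\<Sum>i<K. D * (\<Sum>b<r. (u i b)\<^sup>2)) / real J"
    by (intro divide_right_mono sum_mono lev) (auto intro: sum_nonneg)
  also have "(\<Sum>i<K. D * (\<Sum>b<r. (u i b)\<^sup>2)) = D * (\<Sum>b<r. \<Sum>i<K. u i b * u i b)"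
    by (subst sum.swap) (simp add: sum_distrib_left power2_eq_square)
  also have "(\<Sum>b<r. \<Sum>i<K. u i b * u i b) = real r" using u by (simp add: orthonormalD)
  finally show ?gram .
  assume ortho: "\<And>a c. a < r \<Longrightarrow> c \<in> C \<Longrightarrow> (\<Sum>i<K. u i a * b i c) = 0"
  have "expectation (\<lambda>w. cross_term {..<K} {..<r} C u b (?s w))
      = (\<Sum>a<r. \<Sum>c\<in>C. expectation (\<lambda>w. (\<Sum>i<K. ?s w i * (u i a * b i c))\<^sup>2))"
    unfolding cross_term_def
    by (simp only: Bochner_Integration.integral_sum Bochner_Integration.integrable_sum int0)
  also have "\<dots> \<le> (\<Sum>a<r. \<Sum>c\<in>C. (\<Sum>i<K. (u i a * b i c)\<^sup>2 / q i) / real J)"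
  proof (intro sum_mono)
    fix a c assume ac: "a \<in> {..<r}" "c \<in> C"
    then show "expectation (\<lambda>w. (\<Sum>i<K. ?s w i * (u i a * b i c))\<^sup>2)
        \<le> (\<Sum>i<K. (u i a * b i c)\<^sup>2 / q i) / real J"
      using sample_mean_square_error[OF J, of "\<lambda>i. u i a * b i c"] u0 ortho by simp
  qed
  also have "\<dots> = (\<Sum>i<K. (\<Sum>a<r. (u i a)\<^sup>2) * (\<Sum>c\<in>C. (b i c)\<^sup>2) / q i) / real J"
    unfolding sum_divide_distrib[symmetric] sum_product power_mult_distrib
    by (subst sum.swap[of _ "{..<K}"], subst sum.swap[of _ "{..<K}"]) (simp add: sum_divide_distrib)
  also have "\<dots> \<le> (\<Sum>i<K. D * (\<Sum>c\<in>C. (b i c)\<^sup>2)) / real J"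
    by (intro divide_right_mono sum_mono lev) (auto intro: sum_nonneg)
  finally show "expectation (\<lambda>w. cross_term {..<K} {..<r} C u b (?s w))
        \<le> D * (\<Sum>i<K. \<Sum>c\<in>C. (b i c)\<^sup>2) / real J"
    by (simp add: sum_distrib_left)
qed

text \<open>
  Markov's inequality for the quantity that controls the sketched least squares problem.
\<close>

lemma sketch_good_probability:
  fixes u :: "nat \<Rightarrow> nat \<Rightarrow> real" and r :: nat
  assumes J: "0 < J" and u: "orthonormal {..<K} {..<r} u"
    and D: "0 \<le> D" "\<And>i. i < K \<Longrightarrow> (\<Sum>a<r. (u i a)\<^sup>2) \<le> D * q i"
    and ortho: "\<And>a c. a < r \<Longrightarrow> c \<in> C \<Longrightarrow> (\<Sum>i<K. u i a * b i c) = 0" and \<epsilon>: "0 < \<epsilon>"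
  defines "s \<equiv> \<lambda>w. sample_weight J q (\<lambda>j\<in>{..<J}. v j w)"
    and "\<rho> \<equiv> \<Sum>i<K. \<Sum>c\<in>C. (b i c)\<^sup>2"
  shows "1 - (2 * D * real r + D / \<epsilon>) / real J
    \<le> prob {w \<in> space M. 2 * gram_error {..<K} {..<r} u (s w)
                + cross_term {..<K} {..<r} C u b (s w) / (\<epsilon> * \<rho>) < 1}"
proof -
  define F where "F w = 2 * gram_error {..<K} {..<r} u (s w)
                + cross_term {..<K} {..<r} C u b (s w) / (\<epsilon> * \<rho>)" for w
  have \<rho>: "0 \<le> \<rho>" by (simp add: \<rho>_def sum_nonneg)
  have int: "integrable M (\<lambda>w. gram_error {..<K} {..<r} u (s w))"
    "integrable M (\<lambda>w. cross_term {..<K} {..<r} C u b (s w))"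
    unfolding s_def
    by (rule sample_integrable[of "\<lambda>x. gram_error {..<K} {..<r} u (sample_weight J q x)"],
        rule sample_integrable[of "\<lambda>x. cross_term {..<K} {..<r} C u b (sample_weight J q x)"])
  have F0: "0 \<le> F w" for w
    unfolding F_def gram_error_def cross_term_def using \<epsilon> \<rho>
    by (intro add_nonneg_nonneg divide_nonneg_nonneg mult_nonneg_nonneg sum_nonneg) auto
  have intF: "integrable M F" unfolding F_def using int by simp
  have "expectation F = 2 * expectation (\<lambda>w. gram_error {..<K} {..<r} u (s w))
      + expectation (\<lambda>w. cross_term {..<K} {..<r} C u b (s w)) / (\<epsilon> * \<rho>)"
    unfolding F_def using int by simp
  also have "\<dots> \<le> 2 * (D * real r / real J) + (D * \<rho> / real J) / (\<epsilon> * \<rho>)"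
    unfolding s_def \<rho>_def using \<epsilon>
    by (intro add_mono mult_left_mono divide_right_mono expectation_gram_error_le[OF J u D]
        expectation_cross_term_le[OF J u D ortho] mult_nonneg_nonneg sum_nonneg) auto
  also have "(D * \<rho> / real J) / (\<epsilon> * \<rho>) \<le> D / \<epsilon> / real J"
    using D(1) \<epsilon> \<rho> J by (cases "\<rho> = 0") (auto simp: field_simps)
  finally have EF: "expectation F \<le> (2 * D * real r + D / \<epsilon>) / real J"
    by (simp add: add_divide_distrib)
  have "prob {w \<in> space M. 1 \<le> F w} \<le> expectation F / 1"
    using F0 by (intro integral_Markov_inequality_measure[OF intF]) (auto simp: integral_nonneg)
  moreover have "prob {w \<in> space M. F w < 1} = 1 - prob {w \<in> space M. 1 \<le> F w}"
  proof -
    have "{w \<in> space M. 1 \<le> F w} \<in> events" using intF by measurable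
    then have "prob (space M - {w \<in> space M. 1 \<le> F w}) = 1 - prob {w \<in> space M. 1 \<le> F w}"
      by (rule prob_compl)
    moreover have "space M - {w \<in> space M. 1 \<le> F w} = {w \<in> space M. F w < 1}" by auto
    ultimately show ?thesis by simp
  qed
  ultimately show ?thesis using EF by (simp add: F_def)
qed

end

section \<open>Sketched tensor ring regression\<close>

lemma frob_norm_nonneg: "0 \<le> frob_norm X"
  by (simp add: frob_norm_def sum_nonneg)

lemma frob_norm_power2:
  "X \<in> carrier_mat k m \<Longrightarrow> (frob_norm X)\<^sup>2 = (\<Sum>i<k. \<Sum>c<m. (X $$ (i, c))\<^sup>2)"
  by (auto simp: frob_norm_def sum_nonneg)

definition sample_mat :: "nat \<Rightarrow> nat \<Rightarrow> (nat \<Rightarrow> real) \<Rightarrow> (nat \<Rightarrow> nat) \<Rightarrow> real mat" where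
  "sample_mat J K q x =
     mat J J (\<lambda>(j, l). if j = l then 1 / sqrt (real J * q (x j)) else 0) *
     mat_of_rows K (map (\<lambda>j. unit_vec K (x j)) [0..<J])"

lemma sample_mat_carrier: "sample_mat J K q x \<in> carrier_mat J K"
  by (auto simp: sample_mat_def)

lemma sample_mat_restrict: "sample_mat J K q (\<lambda>j\<in>{..<J}. x j) = sample_mat J K q x"
proof -
  have "map (\<lambda>j. unit_vec K ((\<lambda>j\<in>{..<J}. x j) j)) [0..<J] = map (\<lambda>j. unit_vec K (x j)) [0..<J]"
    by (rule map_cong) auto
  moreover have "mat J J (\<lambda>(j, l). if j = l then 1 / sqrt (real J * q ((\<lambda>j\<in>{..<J}. x j) j)) else 0)
      = mat J J (\<lambda>(j, l). if j = l then 1 / sqrt (real J * q (x j)) else 0)"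
    by (rule cong_mat) auto
  ultimately show ?thesis
    unfolding sample_mat_def by (rule arg_cong2[where f = "\<lambda>Q P. P * mat_of_rows K Q"])
qed

lemma sample_mat_entry:
  assumes "j < J" "i < K" "x j < K"
  shows "sample_mat J K q x $$ (j, i) = (if i = x j then 1 / sqrt (real J * q (x j)) else 0)"
  using assms
  by (simp add: sample_mat_def scalar_prod_def atLeast0LessThan mat_of_rows_index
      if_distrib[of "\<lambda>y. y * _"] cong: if_cong)

text \<open>
  Sketching only reweights the rows, so the sketched objective is a weighted sum of squares.
\<close>

lemma frob_norm_sample_mat:
  assumes X: "X \<in> carrier_mat K m" and x: "\<And>j. j < J \<Longrightarrow> x j < K" and q: "\<And>i. i < K \<Longrightarrow> 0 \<le> q i"
  shows "(frob_norm (sample_mat J K q x * X))\<^sup>2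
    = (\<Sum>i<K. sample_weight J q x i * (\<Sum>c<m. (X $$ (i, c))\<^sup>2))"
proof -
  have c: "sample_mat J K q x * X \<in> carrier_mat J m"
    using sample_mat_carrier X by (rule mult_carrier_mat)
  have entry: "(sample_mat J K q x * X) $$ (j, c) = X $$ (x j, c) / sqrt (real J * q (x j))"
    if "j < J" "c < m" for j c
  proof -
    have "(sample_mat J K q x * X) $$ (j, c) = (\<Sum>i<K. sample_mat J K q x $$ (j, i) * X $$ (i, c))"
      using that X sample_mat_carrier[of J K q x] by (simp add: scalar_prod_def atLeast0LessThan)
    also have "\<dots> = (\<Sum>i<K. if i = x j then X $$ (i, c) / sqrt (real J * q (x j)) else 0)"
      using that x by (intro sum.cong refl) (simp add: sample_mat_entry)
    finally show ?thesis using x[OF that(1)] by simp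
  qed
  have "(frob_norm (sample_mat J K q x * X))\<^sup>2 = (\<Sum>j<J. \<Sum>c<m. (X $$ (x j, c))\<^sup>2 / (real J * q (x j)))"
    unfolding frob_norm_power2[OF c] using x q
    by (intro sum.cong refl) (simp add: entry power_divide)
  also have "\<dots> = (\<Sum>i<K. sample_weight J q x i * (\<Sum>c<m. (X $$ (i, c))\<^sup>2))"
    using x by (simp add: sum_sample_weight sum_divide_distrib)
  finally show ?thesis .
qed

lemma prod_cpred:
  assumes "0 < N"
  shows "(\<Prod>j<N. f (cpred N j)) = (\<Prod>j<N. f j)"
proof (rule prod.reindex_bij_witness[of _ "\<lambda>j. Suc j mod N" "cpred N"])
  fix j assume j: "j \<in> {..<N}"
  then show "Suc (cpred N j) mod N = j"
    unfolding cpred_def mod_Suc_eq using mod_add_self2[of j N] by (cases j) auto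
  show "cpred N j \<in> {..<N}" using assms by (simp add: cpred_def)
  show "Suc j mod N \<in> {..<N}" using assms by simp
  show "cpred N (Suc j mod N) = j"
    using j by (cases "Suc j = N") (auto simp: cpred_def)
qed auto

text \<open>
  Ranging over all cores \<open>Z\<close> is therefore the same as ranging over all matrices.
\<close>

lemma unfold_classical_surj:
  assumes "0 < P" "0 < R"
  obtains Z where "Z \<in> tensors [P, Q, R]"
    "\<And>k c. k < P * R \<Longrightarrow> c < Q \<Longrightarrow> transpose_mat (unfold_classical [P, Q, R] 1 Z) $$ (k, c) = H k c"
proof -
  define Z :: tensor where
    "Z i = (if i \<in> indices [P, Q, R] then H (i ! 0 + P * i ! 2) (i ! 1) else 0)" for i
  show ?thesis
  proof (rule that[of Z])
    show "Z \<in> tensors [P, Q, R]" by (simp add: tensors_def Z_def)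
    fix k c assume k: "k < P * R" and c: "c < Q"
    have "k div P < R" using k by (simp add: less_mult_imp_div_less mult.commute)
    then show "transpose_mat (unfold_classical [P, Q, R] 1 Z) $$ (k, c) = H k c"
      using k c assms by (simp add: unfold_classical_core[unfolded One_nat_def] Z_def indices_def)
  qed
qed

theorem theorem7:
  fixes N n J :: nat and I R :: "nat \<Rightarrow> nat"
    and X :: tensor and G :: "nat \<Rightarrow> tensor"
    and \<epsilon> \<delta> :: real
    and M :: "'w measure" and S :: "'w \<Rightarrow> real mat"
  defines "K \<equiv> \<Prod>j\<in>{..<N} - {n}. I j"
    and "A \<equiv> unfold_cyclic (subchain_dims N I R n) 1 (subchain N I R G n)"
    and "B \<equiv> transpose_mat (unfold_cyclic (map I [0..<N]) n X)"
    and "Zs \<equiv> tensors (core_dims N I R n)"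
    and "Zt \<equiv> \<lambda>Z. transpose_mat (unfold_classical (core_dims N I R n) 1 Z)"
  assumes "3 \<le> N" and "n < N"
    and "\<And>j. j < N \<Longrightarrow> 0 < I j" and "\<And>j. j < N \<Longrightarrow> 0 < R j"
    and "X \<in> tensors (map I [0..<N])"
    and "\<And>j. j < N \<Longrightarrow> G j \<in> tensors (core_dims N I R j)"
    and "\<And>m. m < N \<Longrightarrow> subchain N I R G m \<noteq> (\<lambda>_. 0)"
    and "0 < \<epsilon>" and "\<epsilon> < 1" and "0 < \<delta>" and "\<delta> < 1"
    and "prob_space M"
    and "sampling_matrix M J K (subchain_prob N I R G n) S"
    and "real J > (\<Prod>j<N. (real (R j))\<^sup>2) *
           max (16 / (3 * (sqrt 2 - 1)\<^sup>2) * ln (4 * real (R (cpred N n)) * real (R n) / \<delta>))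
               (4 / (\<epsilon> * \<delta>))"
  shows "measure M {w \<in> space M.
           \<forall>Z. is_arg_min (\<lambda>Z. frob_norm (S w * A * Zt Z - S w * B)) (\<lambda>Z. Z \<in> Zs) Z \<longrightarrow>
               frob_norm (A * Zt Z - B) \<le> (1 + \<epsilon>) * (INF Z'\<in>Zs. frob_norm (A * Zt Z' - B))}
         \<ge> 1 - \<delta>"
proof -
  define q where "q = subchain_prob N I R G n"
  define Rp where "Rp = R (cpred N n)"
  define d where "d = R n * Rp"
  define D where "D = (\<Prod>j\<in>{..<N} - {n}. real (R (cpred N j)) * real (R j))"
  have Rp: "0 < Rp" "0 < R n" using assms by (auto simp: Rp_def cpred_less)
  have D: "0 < D" unfolding D_def using assms by (intro prod_pos) (auto simp: cpred_less)
  have "0 < d" using Rp by (simp add: d_def)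
  then have d: "1 \<le> real d" by simp
  have Rprod: "(\<Prod>j<N. (real (R j))\<^sup>2) = D * real d"
  proof -
    have "(\<Prod>j<N. (real (R j))\<^sup>2) = (\<Prod>j<N. real (R (cpred N j)) * real (R j))"
      using prod_cpred[of N "\<lambda>j. real (R j)"] \<open>n < N\<close> by (simp add: power2_eq_square prod.distrib)
    also have "\<dots> = D * real d"
      using \<open>n < N\<close> by (subst prod.remove[of _ n]) (auto simp: D_def d_def Rp_def)
    finally show ?thesis .
  qed
  \<comment> \<open>Markov's inequality asks for a sample size of order \<open>1 / \<delta>\<close>, which the second entry of the
    maximum supplies.\<close>
  have "D * real d * (4 / (\<epsilon> * \<delta>)) \<le> (\<Prod>j<N. (real (R j))\<^sup>2) *
           max (16 / (3 * (sqrt 2 - 1)\<^sup>2) * ln (4 * real (R (cpred N n)) * real (R n) / \<delta>))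
               (4 / (\<epsilon> * \<delta>))"
    unfolding Rprod using D d by (intro mult_left_mono) auto
  then have J: "D * real d * (4 / (\<epsilon> * \<delta>)) < real J" using assms by linarith
  moreover have "0 < D * real d * (4 / (\<epsilon> * \<delta>))" using D d assms by simp
  ultimately have J0: "0 < J" by linarith

  have A: "A \<in> carrier_mat K d"
    by (simp add: A_def subchain_dims_def unfold_cyclic_subchain[unfolded One_nat_def] K_def d_def Rp_def)
  have Zt: "Zt Z \<in> carrier_mat d (I n)" for Z
    by (simp add: Zt_def core_dims_def unfold_classical_core[unfolded One_nat_def] d_def Rp_def mult.commute)
  have B: "B \<in> carrier_mat K (I n)"
    using \<open>n < N\<close> by (auto simp: B_def unfold_cyclic_def K_def intro!: prod.cong)
  have Zt_surj: "\<exists>Z\<in>Zs. \<forall>k<d. \<forall>c<I n. Zt Z $$ (k, c) = H k c" for H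
    unfolding Zs_def Zt_def core_dims_def
    by (rule unfold_classical_surj[of Rp "R n" "I n" H])
      (use Rp in \<open>auto simp: d_def Rp_def mult.commute\<close>)

  obtain r :: nat and u y \<sigma> where u: "orthonormal {..<K} {..<r} u" and y: "orthonormal {..<d} {..<r} y"
    and \<sigma>: "\<And>k. k < r \<Longrightarrow> 0 < \<sigma> k"
    and Au: "\<And>i j. i \<in> {..<K} \<Longrightarrow> j \<in> {..<d} \<Longrightarrow> A $$ (i, j) = (\<Sum>k<r. \<sigma> k * u i k * y j k)"
    and uA: "\<And>k i. k < r \<Longrightarrow> i \<in> {..<K} \<Longrightarrow> (\<Sum>j<d. A $$ (i, j) * y j k) = \<sigma> k * u i k"
    by (rule singular_value_decomposition[where A = "\<lambda>i j. A $$ (i, j)",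
          OF finite_lessThan[of K] finite_lessThan[of d]], rule that)
  define T where "T l k = y l k / \<sigma> k" for l k
  have uT: "u i k = (\<Sum>l<d. A $$ (i, l) * T l k)" if "i \<in> {..<K}" "k \<in> {..<r}" for i k
    using uA[of k i] \<sigma>[of k] that by (simp add: T_def flip: sum_divide_distrib)
  have AD: "A $$ (i, l) = (\<Sum>k<r. u i k * (\<sigma> k * y l k))" if "i \<in> {..<K}" "l \<in> {..<d}" for i l
    using Au[of i l] that by (simp add: mult_ac)
  have rd: "r \<le> d" using card_le_if_orthonormal[OF y] by simp
  have lev: "(\<Sum>k<r. (u i k)\<^sup>2) \<le> D * q i" if "i < K" for i
    unfolding D_def q_def
  proof (rule subchain_leverage_le[where u = u and T = T, OF assms(7,8)])
    show "orthonormal {..<\<Prod>j\<in>{..<N} - {n}. I j} {..<r} u" using u by (simp add: K_def)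
    show "u a k = (\<Sum>c<R n * R (cpred N n).
        unfold_cyclic (subchain_dims N I R n) 1 (subchain N I R G n) $$ (a, c) * T c k)"
      if "a < (\<Prod>j\<in>{..<N} - {n}. I j)" "k < r" for a k
      using uT[of a k] that unfolding A_def d_def Rp_def K_def by simp
    show "i < (\<Prod>j\<in>{..<N} - {n}. I j)" using that by (simp add: K_def)
  qed

  obtain v where v: "prob_space.indep_vars M (\<lambda>_. count_space {..<K}) v {..<J}"
    "\<And>j i. j < J \<Longrightarrow> i < K \<Longrightarrow> measure M {w \<in> space M. v j w = i} = q i"
    "\<And>w. w \<in> space M \<Longrightarrow> S w = sample_mat J K q (\<lambda>j. v j w)"
    using \<open>sampling_matrix M J K (subchain_prob N I R G n) S\<close>
    unfolding sampling_matrix_def q_def sample_mat_def by blast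
  interpret iid_sampling M J K q v
    by (intro iid_sampling.intro \<open>prob_space M\<close> iid_sampling_axioms.intro v)
  define x where "x w = (\<lambda>j\<in>{..<J}. v j w)" for w
  have Sx: "S w = sample_mat J K q (x w)" if "w \<in> space M" for w
    using v(3)[OF that] by (simp add: x_def sample_mat_restrict)

  \<comment> \<open>The optimal residual is \<open>b\<close>, the part of \<open>B\<close> orthogonal to the column space of \<open>A\<close>.\<close>
  define b where "b i c = B $$ (i, c) - (\<Sum>k<r. u i k * (\<Sum>i<K. u i k * B $$ (i, c)))" for i c
  define \<rho> where "\<rho> = (\<Sum>i<K. \<Sum>c<I n. (b i c)\<^sup>2)"
  define E where "E H i c = (\<Sum>l<d. A $$ (i, l) * H l c) - B $$ (i, c)" for H i c
  define fn where "fn Z k c = Zt Z $$ (k, c)" for Z k c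
  have \<rho>: "0 \<le> \<rho>" by (simp add: \<rho>_def sum_nonneg)
  have res: "A * Zt Z - B \<in> carrier_mat K (I n)" for Z
    using B by (rule minus_carrier_mat)
  have resE: "(A * Zt Z - B) $$ (i, c) = E (fn Z) i c" if "i < K" "c < I n" for Z i c
    using that A B Zt[of Z] by (simp add: E_def fn_def scalar_prod_def atLeast0LessThan)
  have full: "(frob_norm (A * Zt Z - B))\<^sup>2 = (\<Sum>i<K. \<Sum>c<I n. (E (fn Z) i c)\<^sup>2)" for Z
    unfolding frob_norm_power2[OF res] by (simp add: resE)
  have lower: "\<rho> \<le> (frob_norm (A * Zt Z - B))\<^sup>2" for Z
    unfolding full \<rho>_def b_def E_def
    by (rule sketched_least_squares_lower[where B = "\<lambda>i c. B $$ (i, c)",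
          OF finite_lessThan u AD uT])
  have INF: "sqrt \<rho> \<le> (INF Z'\<in>Zs. frob_norm (A * Zt Z' - B))"
  proof (rule cINF_greatest)
    show "Zs \<noteq> {}" using Zt_surj by blast
    show "sqrt \<rho> \<le> frob_norm (A * Zt Z - B)" for Z
      using lower by (intro real_le_lsqrt) (auto simp: frob_norm_nonneg)
  qed

  define good where "good s \<longleftrightarrow> 2 * gram_error {..<K} {..<r} u s
                + cross_term {..<K} {..<r} {..<I n} u b s / (\<epsilon> * \<rho>) < 1" for s
  have main: "frob_norm (A * Zt Z - B) \<le> (1 + \<epsilon>) * (INF Z'\<in>Zs. frob_norm (A * Zt Z' - B))"
    if w: "w \<in> space M" and g: "good (sample_weight J q (x w))"
      and Z: "is_arg_min (\<lambda>Z. frob_norm (S w * A * Zt Z - S w * B)) (\<lambda>Z. Z \<in> Zs) Z" for w Z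
  proof -
    let ?s = "sample_weight J q (x w)"
    have sketch: "(frob_norm (S w * A * Zt Z - S w * B))\<^sup>2
        = (\<Sum>i<K. ?s i * (\<Sum>c<I n. (E (fn Z) i c)\<^sup>2))" for Z
    proof -
      have c: "S w \<in> carrier_mat J K" using Sx[OF w] sample_mat_carrier by simp
      have "S w * A * Zt Z - S w * B = S w * (A * Zt Z - B)"
        using c A B Zt[of Z]
        by (simp add: mult_minus_distrib_mat[of _ J K _ "I n"] assoc_mult_mat[of _ J K _ d _ "I n"])
      then have "(frob_norm (S w * A * Zt Z - S w * B))\<^sup>2
          = (\<Sum>i<K. ?s i * (\<Sum>c<I n. ((A * Zt Z - B) $$ (i, c))\<^sup>2))"
        unfolding Sx[OF w] using v_less[OF _ w] q_nonneg[OF J0]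
        by (simp add: frob_norm_sample_mat[OF res] x_def)
      then show ?thesis by (simp add: resE)
    qed
    have "(\<Sum>i<K. ?s i * (\<Sum>c<I n. (E (fn Z) i c)\<^sup>2)) \<le> (\<Sum>i<K. ?s i * (\<Sum>c<I n. (E H i c)\<^sup>2))" for H
    proof -
      obtain Z' where Z': "Z' \<in> Zs" "\<forall>k<d. \<forall>c<I n. Zt Z' $$ (k, c) = H k c"
        using Zt_surj by blast
      have "frob_norm (S w * A * Zt Z - S w * B) \<le> frob_norm (S w * A * Zt Z' - S w * B)"
        using Z Z'(1) by (auto simp: is_arg_min_def not_less)
      then have "(\<Sum>i<K. ?s i * (\<Sum>c<I n. (E (fn Z) i c)\<^sup>2)) \<le> (\<Sum>i<K. ?s i * (\<Sum>c<I n. (E (fn Z') i c)\<^sup>2))"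
        unfolding sketch[symmetric] by (rule power_mono) (rule frob_norm_nonneg)
      also have "\<dots> = (\<Sum>i<K. ?s i * (\<Sum>c<I n. (E H i c)\<^sup>2))"
        using Z'(2) by (simp add: E_def fn_def)
      finally show ?thesis .
    qed
    from sketched_least_squares_upper[where B = "\<lambda>i c. B $$ (i, c)",
        OF finite_lessThan u AD uT finite_lessThan finite_lessThan \<open>0 < \<epsilon>\<close>
          this[unfolded E_def] g[unfolded good_def \<rho>_def b_def]]
    have "(frob_norm (A * Zt Z - B))\<^sup>2 \<le> (1 + 2 * \<epsilon>) * \<rho>"
      unfolding full \<rho>_def b_def E_def .
    also have "\<dots> \<le> ((1 + \<epsilon>) * sqrt \<rho>)\<^sup>2"
      using \<rho> by (auto simp: power_mult_distrib power2_sum intro!: mult_right_mono)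
    finally have "frob_norm (A * Zt Z - B) \<le> (1 + \<epsilon>) * sqrt \<rho>"
      by (rule power2_le_imp_le) (use \<rho> \<open>0 < \<epsilon>\<close> in simp)
    also have "\<dots> \<le> (1 + \<epsilon>) * (INF Z'\<in>Zs. frob_norm (A * Zt Z' - B))"
      using INF \<open>0 < \<epsilon>\<close> by (intro mult_left_mono) auto
    finally show ?thesis .
  qed

  have ortho: "(\<Sum>i<K. u i a * b i c) = 0" if "a < r" for a c
    unfolding b_def by (rule orthonormal_residual[OF u]) (use that in auto)
  \<comment> \<open>The spare factor \<open>d\<close> in the sample size absorbs the rank \<open>r\<close> that the Gram error contributes.\<close>
  have "2 * D * real r + D / \<epsilon> \<le> 2 * (D * real d / \<epsilon>) + D * real d / \<epsilon>"
  proof (rule add_mono)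
    have "real r * \<epsilon> \<le> real d * 1" using rd \<open>0 < \<epsilon>\<close> \<open>\<epsilon> < 1\<close> by (intro mult_mono) auto
    then show "2 * D * real r \<le> 2 * (D * real d / \<epsilon>)" using D \<open>0 < \<epsilon>\<close> by (simp add: field_simps)
    show "D / \<epsilon> \<le> D * real d / \<epsilon>" using D d \<open>0 < \<epsilon>\<close> by (intro divide_right_mono) auto
  qed
  also have "\<dots> \<le> 4 * (D * real d / \<epsilon>)"
  proof -
    have "0 \<le> D * real d / \<epsilon>" using D d \<open>0 < \<epsilon>\<close> by simp
    moreover have "2 * (D * real d / \<epsilon>) + D * real d / \<epsilon> = 3 * (D * real d / \<epsilon>)" by simp
    ultimately show ?thesis by linarith
  qed
  also have "\<dots> \<le> \<delta> * real J" using J \<open>0 < \<epsilon>\<close> \<open>0 < \<delta>\<close> by (simp add: field_simps)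
  finally have "(2 * D * real r + D / \<epsilon>) / real J \<le> \<delta>" using J0 by (simp add: field_simps)
  moreover have "1 - (2 * D * real r + D / \<epsilon>) / real J
      \<le> prob {w \<in> space M. good (sample_weight J q (x w))}"
    unfolding good_def \<rho>_def x_def
    by (rule sketch_good_probability[OF J0 u _ lev ortho \<open>0 < \<epsilon>\<close>]) (use D in auto)
  ultimately have "1 - \<delta> \<le> prob {w \<in> space M. good (sample_weight J q (x w))}" by linarith
  also have "\<dots> \<le> prob {w \<in> space M.
           \<forall>Z. is_arg_min (\<lambda>Z. frob_norm (S w * A * Zt Z - S w * B)) (\<lambda>Z. Z \<in> Zs) Z \<longrightarrow>
               frob_norm (A * Zt Z - B) \<le> (1 + \<epsilon>) * (INF Z'\<in>Zs. frob_norm (A * Zt Z' - B))}"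
  proof (rule finite_measure_mono)
    have "{w \<in> space M.
           \<forall>Z. is_arg_min (\<lambda>Z. frob_norm (S w * A * Zt Z - S w * B)) (\<lambda>Z. Z \<in> Zs) Z \<longrightarrow>
               frob_norm (A * Zt Z - B) \<le> (1 + \<epsilon>) * (INF Z'\<in>Zs. frob_norm (A * Zt Z' - B))}
      = {w \<in> space M. (\<lambda>x. \<forall>Z. is_arg_min (\<lambda>Z. frob_norm (sample_mat J K q x * A * Zt Z - sample_mat J K q x * B)) (\<lambda>Z. Z \<in> Zs) Z \<longrightarrow>
               frob_norm (A * Zt Z - B) \<le> (1 + \<epsilon>) * (INF Z'\<in>Zs. frob_norm (A * Zt Z' - B))) (\<lambda>j\<in>{..<J}. v j w)}"
      by (auto simp: Sx x_def)
    also have "\<dots> \<in> events" by (rule sample_event)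
    finally show "{w \<in> space M.
           \<forall>Z. is_arg_min (\<lambda>Z. frob_norm (S w * A * Zt Z - S w * B)) (\<lambda>Z. Z \<in> Zs) Z \<longrightarrow>
               frob_norm (A * Zt Z - B) \<le> (1 + \<epsilon>) * (INF Z'\<in>Zs. frob_norm (A * Zt Z' - B))} \<in> events" .
  qed (use main in blast)
  finally show ?thesis .
qed

end
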